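(* There exists a countably infinite sequence $\{\mathcal{P}_n\}_{n\in\omega}$ of non-empty special $\Pi^0_1$ classes such that for every finite sequence $A_0,A_1,\ldots,A_n$ of sets, each of which is a member of some $\mathcal{P}_k$ ($k\in\omega$, where $k$ may depend on the set), the finite join $\bigoplus_{i\leq n} A_i$ does not compute the halting set $K$, i.e. $K\not\leq_T \bigoplus_{i\leq n}A_i$.
   Context: $\omega$ is the set of natural numbers; $2^{<\omega}$ is the set of finite binary strings; a set $A\subseteq\omega$ is identified with its characteristic function, an element of Cantor space $2^\omega$. $\leq_T$ is Turing reducibility. With $\{\Psi_e\}_{e\in\omega}$ an effective enumeration of the Turing functionals, the halting set is $K=\{e:\Psi_e(e)\downarrow\}$. A set $\Lambda\subseteq 2^{<\omega}$ is downward closed if whenever $\sigma\in\Lambda$ and $\tau$ is an initial segment of $\sigma$, then $\tau\in\Lambda$. $[\Lambda]$ denotes the set of infinite paths through $\Lambda$, i.e. all $A\in 2^\omega$ every initial segment of which is in $\Lambda$. A class $\mathcal{P}\subseteq 2^\omega$ is a $\Pi^0_1$ class if $\mathcal{P}=[\Lambda]$ for some computable downward closed set of strings $\Lambda$. A $\Pi^0_1$ class is special if it does not contain a computable member. For sets $A_0,\ldots,A_n$ of natural numbers, the finite join is $\bigoplus_{i\leq n}A_i=\bigcup_{j\leq n}\{(n+1)i+j : i\in A_j\}$. *)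

theory Defs
  imports Main "HOL-Library.Nat_Bijection" "HOL-Library.Sublist"
begin

section \<open>Turing functionals\<close>

text \<open>
  Turing functionals are presented as Kleene's partial recursive functions relative to an oracle.
  All functions are unary: several arguments are passed as one number by means of
  \<^const>\<open>prod_encode\<close>. The only access to the oracle is the scheme \<open>Query\<close>, which returns the value
  of its characteristic function. The identity is \<open>Pairing Proj1 Proj2\<close>.
\<close>

datatype functional =
    Zero
  | Succ
  | Proj1
  | Proj2
  | Query
  | Pairing functional functional
  | Comp functional functional
  | PrimRec functional functional
  | Mu functional

text \<open>\<open>eval A f x y\<close>: the computation of \<open>f\<close> with oracle \<open>A\<close> on input \<open>x\<close> converges with output \<open>y\<close>.\<close>

inductive eval :: "nat set \<Rightarrow> functional \<Rightarrow> nat \<Rightarrow> nat \<Rightarrow> bool" for A :: "nat set" where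
  eval_Zero: "eval A Zero x 0"
| eval_Succ: "eval A Succ x (Suc x)"
| eval_Proj1: "eval A Proj1 x (fst (prod_decode x))"
| eval_Proj2: "eval A Proj2 x (snd (prod_decode x))"
| eval_Query: "eval A Query x (of_bool (x \<in> A))"
| eval_Pairing: "eval A f x y \<Longrightarrow> eval A g x z \<Longrightarrow> eval A (Pairing f g) x (prod_encode (y, z))"
| eval_Comp: "eval A g x y \<Longrightarrow> eval A f y z \<Longrightarrow> eval A (Comp f g) x z"
| eval_PrimRec_0: "eval A f a y \<Longrightarrow> eval A (PrimRec f g) (prod_encode (a, 0)) y"
| eval_PrimRec_Suc: "eval A (PrimRec f g) (prod_encode (a, n)) y \<Longrightarrow>
    eval A g (prod_encode (a, prod_encode (n, y))) z \<Longrightarrow>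
    eval A (PrimRec f g) (prod_encode (a, Suc n)) z"
| eval_Mu: "eval A f (prod_encode (a, n)) 0 \<Longrightarrow>
    (\<forall>m<n. \<exists>y>0. eval A f (prod_encode (a, m)) y) \<Longrightarrow>
    eval A (Mu f) a n"

inductive_cases eval_ZeroE: "eval A Zero x y"
inductive_cases eval_SuccE: "eval A Succ x y"
inductive_cases eval_Proj1E: "eval A Proj1 x y"
inductive_cases eval_Proj2E: "eval A Proj2 x y"
inductive_cases eval_QueryE: "eval A Query x y"
inductive_cases eval_PairingE: "eval A (Pairing f g) x y"
inductive_cases eval_CompE: "eval A (Comp f g) x y"
inductive_cases eval_PrimRecE: "eval A (PrimRec f g) x y"
inductive_cases eval_MuE: "eval A (Mu f) x y"

lemma eval_deterministic: "eval A f x y \<Longrightarrow> eval A f x z \<Longrightarrow> y = z"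
proof (induction arbitrary: z rule: eval.induct)
  case (eval_PrimRec_0 f a y g)
  from eval_PrimRec_0.prems show ?case
    by (rule eval_PrimRecE) (auto dest: eval_PrimRec_0.IH)
next
  case (eval_PrimRec_Suc f g a n y z')
  from eval_PrimRec_Suc.prems show ?case
    by (rule eval_PrimRecE) (auto dest: eval_PrimRec_Suc.IH)
next
  case (eval_Mu f a n)
  from eval_Mu.prems have z: "eval A f (prod_encode (a, z)) 0"
      "\<forall>m<z. \<exists>y>0. eval A f (prod_encode (a, m)) y"
    by (auto elim: eval_MuE)
  show ?case
  proof (rule linorder_cases[of n z])
    assume "n < z"
    then show ?thesis using z(2) eval_Mu.IH(1) by fastforce
  next
    assume "z < n"
    then show ?thesis using z(1) eval_Mu.IH(2) by fastforce
  qed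
qed (blast elim: eval_ZeroE eval_SuccE eval_Proj1E eval_Proj2E eval_QueryE eval_PairingE eval_CompE)+

text \<open>A bijective Goedel numbering; \<open>\<Psi> e\<close> is the functional with number \<open>e\<close>.\<close>

primrec functional_encode :: "functional \<Rightarrow> nat" where
  "functional_encode Zero = 0"
| "functional_encode Succ = 1"
| "functional_encode Proj1 = 2"
| "functional_encode Proj2 = 3"
| "functional_encode Query = 4"
| "functional_encode (Pairing f g) =
    5 + 4 * prod_encode (functional_encode f, functional_encode g)"
| "functional_encode (Comp f g) =
    5 + (4 * prod_encode (functional_encode f, functional_encode g) + 1)"
| "functional_encode (PrimRec f g) =
    5 + (4 * prod_encode (functional_encode f, functional_encode g) + 2)"
| "functional_encode (Mu f) = 5 + (4 * functional_encode f + 3)"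

lemma inj_functional_encode: "inj functional_encode"
proof (rule injI)
  fix f g
  show "functional_encode f = functional_encode g \<Longrightarrow> f = g"
  proof (induction f arbitrary: g)
    case Zero then show ?case by (cases g) simp_all
  next
    case Succ then show ?case by (cases g) simp_all
  next
    case Proj1 then show ?case by (cases g) simp_all
  next
    case Proj2 then show ?case by (cases g) simp_all
  next
    case Query then show ?case by (cases g) simp_all
  next
    case (Pairing f1 f2) then show ?case by (cases g) (simp_all, presburger+)
  next
    case (Comp f1 f2) then show ?case by (cases g) (simp_all, presburger+)
  next
    case (PrimRec f1 f2) then show ?case by (cases g) (simp_all, presburger+)
  next
    case (Mu f) then show ?case by (cases g) (simp_all, presburger+)
  qed
qed

lemma surj_functional_encode: "surj functional_encode"
proof -
  have "\<exists>f. functional_encode f = n" for n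
  proof (induction n rule: less_induct)
    case (less n)
    show ?case
    proof (cases "n < 5")
      case True
      then have "n = 0 \<or> n = 1 \<or> n = 2 \<or> n = 3 \<or> n = 4" by linarith
      then show ?thesis
        by (metis functional_encode.simps(1-5))
    next
      case False
      define q r where "q = (n - 5) div 4" and "r = (n - 5) mod 4"
      have n: "n = 5 + (4 * q + r)" and r: "r < 4"
        using False by (auto simp: q_def r_def)
      obtain a b where ab: "q = prod_encode (a, b)"
        by (metis prod_decode_inverse surj_pair)
      have "a < n" "b < n" "q < n"
        using le_prod_encode_1[of a b] le_prod_encode_2[of b a] n ab by linarith+
      then obtain f g h where "functional_encode f = a" "functional_encode g = b"
          "functional_encode h = q"
        using less.IH by metis
      then have "functional_encode (Pairing f g) = 5 + (4 * q + 0)"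
          "functional_encode (Comp f g) = 5 + (4 * q + 1)"
          "functional_encode (PrimRec f g) = 5 + (4 * q + 2)"
          "functional_encode (Mu h) = 5 + (4 * q + 3)"
        by (simp_all add: ab)
      moreover have "r = 0 \<or> r = 1 \<or> r = 2 \<or> r = 3" using r by linarith
      ultimately show ?thesis unfolding n by metis
    qed
  qed
  then show ?thesis by (metis surjI)
qed

lemma bij_functional_encode: "bij functional_encode"
  using inj_functional_encode surj_functional_encode by (rule bijI)

definition \<Psi> :: "nat \<Rightarrow> functional" where
  "\<Psi> e = inv functional_encode e"

section \<open>Turing reducibility, computability and the halting set\<close>

definition turing_reducible :: "nat set \<Rightarrow> nat set \<Rightarrow> bool" (infix "\<le>\<^sub>T" 50) where
  "A \<le>\<^sub>T B \<longleftrightarrow> (\<exists>e. \<forall>x. eval B (\<Psi> e) x (of_bool (x \<in> A)))"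

definition computable :: "nat set \<Rightarrow> bool" where
  "computable A \<longleftrightarrow> A \<le>\<^sub>T {}"

definition halting_set :: "nat set" where
  "halting_set = {e. \<exists>y. eval {} (\<Psi> e) e y}"

section \<open>Effectively closed classes\<close>

definition string_encode :: "bool list \<Rightarrow> nat" where
  "string_encode \<sigma> = list_encode (map of_bool \<sigma>)"

definition computable_strings :: "bool list set \<Rightarrow> bool" where
  "computable_strings \<Lambda> \<longleftrightarrow> computable (string_encode ` \<Lambda>)"

definition downward_closed :: "bool list set \<Rightarrow> bool" where
  "downward_closed \<Lambda> \<longleftrightarrow> (\<forall>\<sigma>\<in>\<Lambda>. \<forall>\<tau>. prefix \<tau> \<sigma> \<longrightarrow> \<tau> \<in> \<Lambda>)"

definition initial_segment :: "nat set \<Rightarrow> nat \<Rightarrow> bool list" where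
  "initial_segment A n = map (\<lambda>i. i \<in> A) [0..<n]"

definition paths :: "bool list set \<Rightarrow> nat set set" where
  "paths \<Lambda> = {A. \<forall>n. initial_segment A n \<in> \<Lambda>}"

definition pi01_class :: "nat set set \<Rightarrow> bool" where
  "pi01_class P \<longleftrightarrow> (\<exists>\<Lambda>. computable_strings \<Lambda> \<and> downward_closed \<Lambda> \<and> P = paths \<Lambda>)"

definition special_pi01_class :: "nat set set \<Rightarrow> bool" where
  "special_pi01_class P \<longleftrightarrow> pi01_class P \<and> \<not> (\<exists>A\<in>P. computable A)"

text \<open>The join of the \<open>n + 1\<close> sets \<open>A 0, \<dots>, A n\<close>; the values \<open>A j\<close> for \<open>j > n\<close> are irrelevant.\<close>

definition finite_join :: "nat \<Rightarrow> (nat \<Rightarrow> nat set) \<Rightarrow> nat set" where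
  "finite_join n A = (\<Union>j\<le>n. {(n + 1) * i + j | i. i \<in> A j})"

end

theory Submission
  imports Defs
begin

text \<open>
  A single class \<open>P\<close> serves for all \<open>n\<close>. It is built as the set of paths through a tree of levels,
  together with a computably enumerable set \<open>C\<close>, by a finite injury argument; since \<open>C\<close> is reducible
  to \<open>K\<close>, it suffices that no join of members of \<open>P\<close> computes \<open>C\<close>.

  At every stage there are finitely many levels; the nodes of each level are pairwise incomparable
  strings, and those of the next level start as their two immediate successors. Level \<open>k\<close> looks after
  finitely many requirements \<open>(e, ps)\<close>, where \<open>ps\<close> is a list of nodes of that level, and has a fresh
  witness \<open>x\<close> for each of them. When all its nodes can be extended inside the current tree so that
  functional \<open>e\<close> with the join of the nodes in \<open>ps\<close> as oracle maps \<open>x\<close> to 0, the nodes are moved to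
  these extensions, \<open>x\<close> enters \<open>C\<close>, and all higher levels are discarded. This preserves the
  computation, so \<open>e\<close> does not compute \<open>C\<close> from members of \<open>P\<close> through these nodes. If the opportunity
  never arises, \<open>x\<close> stays out of \<open>C\<close>, and \<open>e\<close> does not map \<open>x\<close> to 0. Finitely many distinct members of
  \<open>P\<close> pass through distinct nodes of almost every level. The requirements with empty \<open>ps\<close> move all
  nodes away from the set computed by \<open>e\<close>, which makes \<open>P\<close> special. Every level settles, as it acts at
  most once for each of its requirements after the lower levels have settled.
\<close>

section \<open>Total computable functions on encoded data\<close>

definition total_in :: "nat set \<Rightarrow> (nat \<Rightarrow> nat) \<Rightarrow> bool" where
  "total_in A f \<longleftrightarrow> (\<exists>F. \<forall>n. eval A F n (f n))"

lemma total_inI: "(\<And>n. eval A F n (f n)) \<Longrightarrow> total_in A f" for F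
  unfolding total_in_def by blast

lemma total_in_comp:
  assumes "total_in A f" "total_in A g"
  shows "total_in A (\<lambda>n. f (g n))"
proof -
  obtain F G where "\<And>n. eval A F n (f n)" "\<And>n. eval A G n (g n)"
    using assms unfolding total_in_def by blast
  then show ?thesis by (intro total_inI[where F = "Comp F G"] eval_Comp)
qed

lemma total_in_pair:
  assumes "total_in A f" "total_in A g"
  shows "total_in A (\<lambda>n. prod_encode (f n, g n))"
proof -
  obtain F G where "\<And>n. eval A F n (f n)" "\<And>n. eval A G n (g n)"
    using assms unfolding total_in_def by blast
  then show ?thesis by (intro total_inI[where F = "Pairing F G"] eval_Pairing)
qed

lemma total_in_fst: "total_in A (\<lambda>n. fst (prod_decode n))"
  by (rule total_inI, rule eval_Proj1)

lemma total_in_snd: "total_in A (\<lambda>n. snd (prod_decode n))"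
  by (rule total_inI, rule eval_Proj2)

lemma total_in_Suc: "total_in A Suc"
  by (rule total_inI, rule eval_Succ)

lemma total_in_member: "total_in A (\<lambda>n. of_bool (n \<in> A))"
  by (rule total_inI, rule eval_Query)

lemma total_in_id: "total_in A (\<lambda>n. n)"
  using total_in_pair[OF total_in_fst total_in_snd] by simp

lemma total_in_const: "total_in A (\<lambda>_. c)"
proof (induction c)
  case 0
  show ?case by (rule total_inI, rule eval_Zero)
next
  case (Suc c)
  then show ?case by (rule total_in_comp[OF total_in_Suc])
qed

text \<open>The parameter of \<open>PrimRec\<close> is the whole input \<open>w\<close>, so that the
  initial value, the step and the number of rounds may all depend on it.\<close>

lemma total_in_rec:
  assumes "total_in A a" "total_in A g" "total_in A h"
  shows "total_in A (\<lambda>w. rec_nat (a w) (\<lambda>i y. g (prod_encode (w, prod_encode (i, y)))) (h w))"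
proof -
  obtain a' g' where a': "\<And>n. eval A a' n (a n)" and g': "\<And>n. eval A g' n (g n)"
    using assms unfolding total_in_def by blast
  let ?R = "\<lambda>w n. rec_nat (a w) (\<lambda>i y. g (prod_encode (w, prod_encode (i, y)))) n"
  have "eval A (PrimRec a' g') (prod_encode (w, n)) (?R w n)" for w n
  proof (induction n)
    case 0
    show ?case using eval_PrimRec_0[OF a'] by simp
  next
    case (Suc n)
    show ?case using eval_PrimRec_Suc[OF Suc g'] by simp
  qed
  then have "eval A (PrimRec a' g') n (?R (fst (prod_decode n)) (snd (prod_decode n)))" for n
    by (metis prod.collapse prod_decode_inverse)
  then have "total_in A (\<lambda>n. ?R (fst (prod_decode n)) (snd (prod_decode n)))"
    by (rule total_inI)
  from total_in_comp[OF this total_in_pair[OF total_in_id assms(3)]] show ?thesis by simp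
qed

section \<open>Encodings of data types and functions computable on codes\<close>

class encodable =
  fixes enc :: "'a \<Rightarrow> nat"
  assumes enc_eq_iff [simp]: "enc x = enc y \<longleftrightarrow> x = y"

instantiation nat :: encodable
begin
definition enc_nat_def [simp]: "enc (n :: nat) = n"
instance by standard simp
end

instantiation bool :: encodable
begin
definition enc_bool_def [simp]: "enc (b :: bool) = of_bool b"
instance by standard simp
end

instantiation prod :: (encodable, encodable) encodable
begin
definition enc_prod_def [simp]: "enc p = prod_encode (enc (fst p), enc (snd p))"
instance by standard (simp add: prod_eq_iff)
end

instantiation list :: (encodable) encodable
begin
definition enc_list_def: "enc xs = list_encode (map enc xs)"
instance by standard (simp add: enc_list_def list_encode_eq inj_map_eq_map inj_def)
end

lemma enc_Nil [simp]: "enc [] = 0"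
  by (simp add: enc_list_def)

lemma enc_Cons [simp]: "enc (x # xs) = Suc (prod_encode (enc x, enc xs))"
  by (simp add: enc_list_def)

lemma enc_nat_list [simp]: "enc (xs :: nat list) = list_encode xs"
  by (simp add: enc_list_def map_idI)

text \<open>
  The tracking function has to be total on all numbers, including those that are not codes, since
  primitive recursion may be forced to evaluate it there.
\<close>

definition eff :: "nat set \<Rightarrow> ('a::encodable \<Rightarrow> 'b::encodable) \<Rightarrow> bool" where
  "eff A f \<longleftrightarrow> (\<exists>g. total_in A g \<and> (\<forall>x. g (enc x) = enc (f x)))"

named_theorems eff_intros

lemma effI: "total_in A g \<Longrightarrow> (\<And>x. g (enc x) = enc (f x)) \<Longrightarrow> eff A f"
  unfolding eff_def by blast

lemma eff_cong: "eff A f \<Longrightarrow> (\<And>v. f v = g v) \<Longrightarrow> eff A g"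
  by (simp add: eff_def)

lemma eff_id [eff_intros]: "eff A (\<lambda>v. v)"
  by (rule effI[OF total_in_id]) simp

lemma eff_const [eff_intros]: "eff A (\<lambda>_. c)"
  by (rule effI[OF total_in_const]) simp

lemma eff_comp:
  assumes "eff A f" "eff A g"
  shows "eff A (\<lambda>v. f (g v))"
proof -
  obtain f' g' where "total_in A f'" "\<And>x. f' (enc x) = enc (f x)"
    "total_in A g'" "\<And>x. g' (enc x) = enc (g x)"
    using assms unfolding eff_def by metis
  then show ?thesis by (intro effI[OF total_in_comp[of A f' g']]) simp_all
qed

lemma eff_Pair [eff_intros]:
  assumes "eff A f" "eff A g"
  shows "eff A (\<lambda>v. (f v, g v))"
proof -
  obtain f' g' where "total_in A f'" "\<And>x. f' (enc x) = enc (f x)"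
    "total_in A g'" "\<And>x. g' (enc x) = enc (g x)"
    using assms unfolding eff_def by metis
  then show ?thesis by (intro effI[OF total_in_pair[of A f' g']]) simp_all
qed

lemma eff_comp2:
  assumes "eff A (\<lambda>p. c (fst p) (snd p))" "eff A f" "eff A g"
  shows "eff A (\<lambda>v. c (f v) (g v))"
  using eff_comp[OF assms(1) eff_Pair[OF assms(2,3)]] by simp

lemma eff_comp3:
  assumes "eff A (\<lambda>p. c (fst p) (fst (snd p)) (snd (snd p)))" "eff A f" "eff A g" "eff A h"
  shows "eff A (\<lambda>v. c (f v) (g v) (h v))"
  using eff_comp[OF assms(1) eff_Pair[OF assms(2) eff_Pair[OF assms(3,4)]]] by simp

lemma eff_fst [eff_intros]: "eff A f \<Longrightarrow> eff A (\<lambda>v. fst (f v))"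
  by (rule eff_comp[where f = fst]) (rule effI[OF total_in_fst], simp)

lemma eff_snd [eff_intros]: "eff A f \<Longrightarrow> eff A (\<lambda>v. snd (f v))"
  by (rule eff_comp[where f = snd]) (rule effI[OF total_in_snd], simp)

lemma eff_Suc [eff_intros]: "eff A f \<Longrightarrow> eff A (\<lambda>v. Suc (f v))"
  by (rule eff_comp[where f = Suc]) (rule effI[OF total_in_Suc], simp)

lemma eff_enc [eff_intros]: "eff A f \<Longrightarrow> eff A (\<lambda>v. enc (f v))"
  by (rule eff_comp[where f = enc]) (rule effI[OF total_in_id], simp)

lemma eff_prod_decode [eff_intros]: "eff A f \<Longrightarrow> eff A (\<lambda>v. prod_decode (f v))"
  by (rule eff_comp[where f = prod_decode]) (rule effI[OF total_in_id], simp)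

lemma eff_prod_encode [eff_intros]: "eff A f \<Longrightarrow> eff A (\<lambda>v. prod_encode (f v))"
  by (rule eff_comp[where f = prod_encode]) (rule effI[OF total_in_id], simp)

lemma eff_list_decode [eff_intros]: "eff A f \<Longrightarrow> eff A (\<lambda>v. list_decode (f v))"
  by (rule eff_comp[where f = list_decode]) (rule effI[OF total_in_id], simp)

lemma eff_list_encode [eff_intros]: "eff A f \<Longrightarrow> eff A (\<lambda>v. list_encode (f v))"
  by (rule eff_comp[where f = list_encode]) (rule effI[OF total_in_id], simp)

lemma eff_member: "eff A f \<Longrightarrow> eff A (\<lambda>v. f v \<in> A)"
  by (rule eff_comp[where f = "\<lambda>n. n \<in> A"]) (rule effI[OF total_in_member], simp)

lemma eff_case_prod [eff_intros]:
  assumes "eff A (\<lambda>p. g (fst p) (fst (snd p)) (snd (snd p)))" "eff A h"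
  shows "eff A (\<lambda>v. case_prod (g v) (h v))"
  using eff_comp[OF assms(1) eff_Pair[OF eff_id assms(2)]] by (simp add: case_prod_beta)

lemma eff_Let [eff_intros]:
  assumes "eff A (\<lambda>p. g (fst p) (snd p))" "eff A h"
  shows "eff A (\<lambda>v. Let (h v) (g v))"
  using eff_comp[OF assms(1) eff_Pair[OF eff_id assms(2)]] by simp

lemma eff_rec_nat [eff_intros]:
  assumes "eff A a" "eff A (\<lambda>p. g (fst p) (fst (snd p)) (snd (snd p)))" "eff A n"
  shows "eff A (\<lambda>v. rec_nat (a v) (g v) (n v))"
proof -
  obtain a' g' n' where a': "total_in A a'" "\<And>x. a' (enc x) = enc (a x)"
    and g': "total_in A g'" "\<And>x. g' (enc x) = enc (g (fst x) (fst (snd x)) (snd (snd x)))"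
    and n': "total_in A n'" "\<And>x. n' (enc x) = enc (n x)"
    using assms unfolding eff_def by metis
  have "rec_nat (a' (enc v)) (\<lambda>i y. g' (prod_encode (enc v, prod_encode (i, y)))) m
      = enc (rec_nat (a v) (g v) m)" for v m
  proof (induction m)
    case (Suc m)
    then show ?case using g'(2)[of "(v, m, rec_nat (a v) (g v) m)"] by simp
  qed (simp add: a')
  then show ?thesis
    by (intro effI[OF total_in_rec[OF a'(1) g'(1) n'(1)]]) (simp add: n'(2))
qed

lemma eff_case_nat [eff_intros]:
  assumes "eff A a" "eff A (\<lambda>p. g (fst p) (snd p))" "eff A n"
  shows "eff A (\<lambda>v. case_nat (a v) (g v) (n v))"
proof -
  have "eff A (\<lambda>v. rec_nat (a v) (\<lambda>i _. g v i) (n v))"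
    by (intro eff_rec_nat assms(1,3)) (rule eff_comp2[OF assms(2)], (intro eff_intros)+)
  moreover have "rec_nat x (\<lambda>i _. h i) m = case_nat x h m" for x :: 'b and h m
    by (cases m) simp_all
  ultimately show ?thesis by simp
qed

text \<open>Booleans are coded by 0 and 1, which reduces the choice to a case distinction on a
  number.\<close>

lemma eff_If [eff_intros]:
  assumes "eff A b" "eff A f" "eff A g"
  shows "eff A (\<lambda>v. if b v then f v else g v)"
proof -
  have "eff A (\<lambda>v. case_nat (g v) (\<lambda>_. f v) (enc (b v)))"
    by (intro eff_case_nat assms eff_enc) (rule eff_comp[OF assms(2)], intro eff_intros)
  moreover have "case_nat y (\<lambda>_. x) (enc c) = (if c then x else y)" for c and x y :: 'b
    by simp
  ultimately show ?thesis by simp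
qed

lemma eff_not [eff_intros]: "eff A b \<Longrightarrow> eff A (\<lambda>v. \<not> b v)"
  by (rule eff_cong[of A "\<lambda>v. if b v then False else True"]) (intro eff_If eff_const, auto)

lemma eff_conj [eff_intros]: "eff A b \<Longrightarrow> eff A c \<Longrightarrow> eff A (\<lambda>v. b v \<and> c v)"
  by (rule eff_cong[of A "\<lambda>v. if b v then c v else False"]) (intro eff_If eff_const, auto)

lemma eff_disj [eff_intros]: "eff A b \<Longrightarrow> eff A c \<Longrightarrow> eff A (\<lambda>v. b v \<or> c v)"
  by (rule eff_cong[of A "\<lambda>v. if b v then True else c v"]) (intro eff_If eff_const, auto)

lemma eff_imp [eff_intros]: "eff A b \<Longrightarrow> eff A c \<Longrightarrow> eff A (\<lambda>v. b v \<longrightarrow> c v)"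
  by (rule eff_cong[of A "\<lambda>v. if b v then c v else True"]) (intro eff_If eff_const, auto)

lemma eff_add [eff_intros]:
  assumes "eff A f" "eff A g"
  shows "eff A (\<lambda>v. f v + g v :: nat)"
proof -
  have "eff A (\<lambda>v. rec_nat (f v) (\<lambda>_ y. Suc y) (g v))"
    by (intro eff_intros assms)
  moreover have "rec_nat m (\<lambda>_ y. Suc y) n = m + n" for m n
    by (induction n) simp_all
  ultimately show ?thesis by simp
qed

lemma eff_mult [eff_intros]:
  assumes "eff A f" "eff A g"
  shows "eff A (\<lambda>v. f v * g v :: nat)"
proof -
  have "eff A (\<lambda>v. rec_nat 0 (\<lambda>_ y. y + f v) (g v))"
    by (intro eff_intros assms, rule eff_comp[OF assms(1)], intro eff_intros)
  moreover have "rec_nat 0 (\<lambda>_ y. y + m) n = m * n" for m n :: nat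
    by (induction n) simp_all
  ultimately show ?thesis by simp
qed

lemma eff_diff [eff_intros]:
  assumes "eff A f" "eff A g"
  shows "eff A (\<lambda>v. f v - g v :: nat)"
proof -
  have "eff A (\<lambda>v. rec_nat (f v) (\<lambda>_ y. case y of 0 \<Rightarrow> 0 | Suc x \<Rightarrow> x) (g v))"
    by (intro eff_intros assms)
  moreover have "rec_nat m (\<lambda>_ y. case y of 0 \<Rightarrow> 0 | Suc x \<Rightarrow> x) n = m - n" for m n :: nat
    by (induction n) (auto split: nat.split)
  ultimately show ?thesis by simp
qed

lemma eff_le [eff_intros]:
  assumes "eff A f" "eff A g"
  shows "eff A (\<lambda>v. f v \<le> (g v :: nat))"
proof -
  have "eff A (\<lambda>v. case f v - g v of 0 \<Rightarrow> True | Suc _ \<Rightarrow> False)"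
    by (intro eff_intros assms)
  then show ?thesis by (rule eff_cong) (auto split: nat.split)
qed

lemma eff_less [eff_intros]:
  assumes "eff A f" "eff A g"
  shows "eff A (\<lambda>v. f v < (g v :: nat))"
  using eff_not[OF eff_le[OF assms(2,1)]] by (simp add: not_le)

lemma eff_eq [eff_intros]:
  assumes "eff A f" "eff A g"
  shows "eff A (\<lambda>v. f v = g v)"
proof -
  have "eff A (\<lambda>v. enc (f v) \<le> enc (g v) \<and> enc (g v) \<le> enc (f v))"
    by (intro eff_intros assms)
  then show ?thesis by (rule eff_cong) (auto simp flip: order_eq_iff)
qed

text \<open>A counter that wraps around at the modulus. For modulus 0 it never wraps, in accordance
  with \<open>n mod 0 = n\<close>.\<close>

lemma eff_mod [eff_intros]:
  assumes "eff A f" "eff A g"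
  shows "eff A (\<lambda>v. f v mod g v :: nat)"
proof -
  have "eff A (\<lambda>v. rec_nat 0 (\<lambda>_ y. if Suc y = g v then 0 else Suc y) (f v))"
    by (intro eff_intros assms, rule eff_comp[OF assms(2)], intro eff_intros)
  moreover have "rec_nat 0 (\<lambda>_ y. if Suc y = m then 0 else Suc y) n = n mod m" for m n :: nat
    by (induction n) (simp_all add: mod_Suc)
  ultimately show ?thesis by simp
qed

lemma eff_div [eff_intros]:
  assumes "eff A f" "eff A g"
  shows "eff A (\<lambda>v. f v div g v :: nat)"
proof -
  have "eff A (\<lambda>v. rec_nat 0 (\<lambda>i y. if Suc (i mod g v) = g v then Suc y else y) (f v))"
    by (intro eff_intros assms; rule eff_comp[OF assms(2)], intro eff_intros)
  moreover have "rec_nat 0 (\<lambda>i y. if Suc (i mod m) = m then Suc y else y) n = n div m" for m n :: nat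
    by (induction n) (simp_all add: div_Suc mod_Suc dvd_eq_mod_eq_0)
  ultimately show ?thesis by simp
qed

lemma eff_Cons [eff_intros]:
  assumes "eff A f" "eff A g"
  shows "eff A (\<lambda>v. f v # g v)"
proof -
  obtain f' g' where "total_in A f'" "\<And>x. f' (enc x) = enc (f x)"
    "total_in A g'" "\<And>x. g' (enc x) = enc (g x)"
    using assms unfolding eff_def by metis
  then show ?thesis
    by (intro effI[OF total_in_comp[OF total_in_Suc total_in_pair[of A f' g']]]) simp_all
qed

lemma eff_case_list [eff_intros]:
  assumes "eff A a" "eff A (\<lambda>p. g (fst p) (fst (snd p)) (snd (snd p)))" "eff A xs"
  shows "eff A (\<lambda>v. case_list (a v) (g v) (xs v))"
proof -
  obtain a' g' xs' where a': "total_in A a'" "\<And>x. a' (enc x) = enc (a x)"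
    and g': "total_in A g'" "\<And>x. g' (enc x) = enc (g (fst x) (fst (snd x)) (snd (snd x)))"
    and xs': "total_in A xs'" "\<And>x. xs' (enc x) = enc (xs x)"
    using assms unfolding eff_def by metis
  \<comment> \<open>A nonempty list has code \<open>Suc i\<close>, where \<open>i\<close> codes the
    pair of head and tail, so one recursion step on the code exposes both; the recursive value is
    ignored.\<close>
  let ?r = "\<lambda>w. rec_nat (a' w) (\<lambda>i _. g' (prod_encode (w, i))) (xs' w)"
  have "total_in A (\<lambda>w. g' (prod_encode (fst (prod_decode w),
      fst (prod_decode (snd (prod_decode w))))))"
    by (intro total_in_comp[OF g'(1)] total_in_pair total_in_fst
        total_in_comp[OF total_in_fst total_in_snd])
  from total_in_rec[OF a'(1) this xs'(1)] have "total_in A ?r" by simp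
  moreover have "?r (enc v) = enc (case_list (a v) (g v) (xs v))" for v
    using g'(2)[of "(v, _, _)"] by (cases "xs v") (simp_all add: a' xs')
  ultimately show ?thesis by (rule effI)
qed

section \<open>Recursion on lists\<close>

lemma length_le_enc: "length xs \<le> enc xs"
proof (induction xs)
  case (Cons x xs)
  have "length xs \<le> prod_encode (enc x, enc xs)"
    using Cons le_prod_encode_2 by (rule le_trans)
  then show ?case by simp
qed simp

text \<open>The iterated state holds the accumulator and the part of the list still to be read. An
  exhausted list is a fixed point, so any bound on the length serves as number of rounds, in
  particular the code of the list.\<close>

lemma foldl_eq_rec_nat:
  assumes "length xs \<le> n"
  shows "foldl f a xs = fst (rec_nat (a, xs)
    (\<lambda>_ p. case snd p of [] \<Rightarrow> p | x # ys \<Rightarrow> (f (fst p) x, ys)) n)" (is "_ = fst (rec_nat _ ?st n)")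
proof -
  \<comment> \<open>A round can be peeled off at either end because the step ignores the
    counter.\<close>
  have shift: "rec_nat p ?st (Suc m) = rec_nat (?st 0 p) ?st m" for p m
    by (induction m) simp_all
  show ?thesis using assms
  proof (induction n arbitrary: a xs)
    case (Suc n)
    show ?case
    proof (cases xs)
      case Nil
      have "rec_nat (a, []) ?st m = (a, [])" for m
        by (induction m) simp_all
      then show ?thesis using Nil by simp
    next
      case (Cons y ys)
      then show ?thesis using Suc.IH[of ys "f a y"] Suc.prems by (simp only: shift) simp
    qed
  qed simp
qed

lemma eff_foldl:
  assumes "eff A a" "eff A (\<lambda>p. g (fst p) (fst (snd p)) (snd (snd p)))" "eff A xs"
  shows "eff A (\<lambda>v. foldl (g v) (a v) (xs v))"
  unfolding foldl_eq_rec_nat[OF length_le_enc]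
  by (intro eff_intros assms eff_comp3[OF assms(2)])

lemma eff_rev [eff_intros]:
  assumes "eff A xs"
  shows "eff A (\<lambda>v. rev (xs v))"
proof -
  have "eff A (\<lambda>v. foldl (\<lambda>ys x. x # ys) [] (xs v))"
    by (intro eff_foldl eff_intros assms)
  moreover have "foldl (\<lambda>ys x. x # ys) zs xs = rev xs @ zs" for zs and xs :: "'b list"
    by (induction xs arbitrary: zs) simp_all
  ultimately show ?thesis by simp
qed

text \<open>Folding over the reversed list meets the tails from the shortest up; carrying the
  current tail along supplies the second argument of \<open>f\<close>.\<close>

lemma rec_list_eq_foldl:
  "rec_list a f xs = fst (foldl (\<lambda>p x. (f x (snd p) (fst p), x # snd p)) (a, []) (rev xs))"
proof -
  have "foldl (\<lambda>p x. (f x (snd p) (fst p), x # snd p)) (a, []) (rev xs) = (rec_list a f xs, xs)"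
    by (induction xs) simp_all
  then show ?thesis by simp
qed

lemma eff_rec_list [eff_intros]:
  assumes "eff A a" "eff A (\<lambda>p. g (fst p) (fst (snd p)) (fst (snd (snd p))) (snd (snd (snd p))))" "eff A xs"
  shows "eff A (\<lambda>v. rec_list (a v) (g v) (xs v))"
  unfolding rec_list_eq_foldl
  by (intro eff_intros eff_foldl assms eff_comp[OF assms(2),
      where g = "\<lambda>p. (fst p, snd (snd p), snd (fst (snd p)), fst (fst (snd p)))", simplified])

lemma eff_append [eff_intros]:
  assumes "eff A f" "eff A g"
  shows "eff A (\<lambda>v. f v @ g v)"
proof -
  have "eff A (\<lambda>v. rec_list (g v) (\<lambda>x _ ys. x # ys) (f v))"
    by (intro eff_intros assms)
  moreover have "rec_list ys (\<lambda>x _ ys. x # ys) xs = xs @ ys" for xs ys :: "'b list"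
    by (induction xs) simp_all
  ultimately show ?thesis by simp
qed

lemma eff_length [eff_intros]:
  assumes "eff A f"
  shows "eff A (\<lambda>v. length (f v))"
proof -
  have "eff A (\<lambda>v. rec_list 0 (\<lambda>_ _ n. Suc n) (f v))"
    by (intro eff_intros assms)
  moreover have "rec_list 0 (\<lambda>_ _ n. Suc n) xs = length xs" for xs :: "'b list"
    by (induction xs) simp_all
  ultimately show ?thesis by simp
qed

lemma eff_map [eff_intros]:
  assumes "eff A (\<lambda>p. g (fst p) (snd p))" "eff A xs"
  shows "eff A (\<lambda>v. map (g v) (xs v))"
proof -
  have "eff A (\<lambda>v. rec_list [] (\<lambda>x _ ys. g v x # ys) (xs v))"
    by (intro eff_intros assms eff_comp2[OF assms(1)])
  moreover have "rec_list [] (\<lambda>x _ ys. f x # ys) xs = map f xs" for f :: "'b \<Rightarrow> 'c" and xs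
    by (induction xs) simp_all
  ultimately show ?thesis by simp
qed

lemma eff_list_all [eff_intros]:
  assumes "eff A (\<lambda>p. g (fst p) (snd p))" "eff A xs"
  shows "eff A (\<lambda>v. list_all (g v) (xs v))"
proof -
  have "eff A (\<lambda>v. rec_list True (\<lambda>x _ b. g v x \<and> b) (xs v))"
    by (intro eff_intros assms eff_comp2[OF assms(1)])
  moreover have "rec_list True (\<lambda>x _ b. f x \<and> b) xs = list_all f xs" for f :: "'b \<Rightarrow> bool" and xs
    by (induction xs) simp_all
  ultimately show ?thesis by simp
qed

lemma eff_list_ex [eff_intros]:
  assumes "eff A (\<lambda>p. g (fst p) (snd p))" "eff A xs"
  shows "eff A (\<lambda>v. list_ex (g v) (xs v))"
proof -
  have "eff A (\<lambda>v. rec_list False (\<lambda>x _ b. g v x \<or> b) (xs v))"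
    by (intro eff_intros assms eff_comp2[OF assms(1)])
  moreover have "rec_list False (\<lambda>x _ b. f x \<or> b) xs = list_ex f xs" for f :: "'b \<Rightarrow> bool" and xs
    by (induction xs) simp_all
  ultimately show ?thesis by simp
qed

lemma eff_concat [eff_intros]:
  assumes "eff A xs"
  shows "eff A (\<lambda>v. concat (xs v))"
proof -
  have "eff A (\<lambda>v. rec_list [] (\<lambda>x _ ys. x @ ys) (xs v))"
    by (intro eff_intros assms)
  moreover have "rec_list [] (\<lambda>x _ ys. x @ ys) xs = concat xs" for xs :: "'b list list"
    by (induction xs) simp_all
  ultimately show ?thesis by simp
qed

lemma eff_upt [eff_intros]:
  assumes "eff A n"
  shows "eff A (\<lambda>v. [0..<n v])"
proof -
  have "eff A (\<lambda>v. rec_nat [] (\<lambda>i ys. ys @ [i]) (n v))"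
    by (intro eff_intros assms)
  moreover have "rec_nat [] (\<lambda>i ys. ys @ [i]) m = [0..<m]" for m
    by (induction m) simp_all
  ultimately show ?thesis by simp
qed

lemma eff_in_set [eff_intros]:
  assumes "eff A f" "eff A xs"
  shows "eff A (\<lambda>v. f v \<in> set (xs v))"
proof -
  have "eff A (\<lambda>v. list_ex (\<lambda>x. f v = x) (xs v))"
    by (intro eff_intros assms eff_comp[OF assms(1)])
  then show ?thesis by (simp add: list_ex_iff)
qed

lemma eff_prefix [eff_intros]:
  assumes "eff A f" "eff A g"
  shows "eff A (\<lambda>v. prefix (f v) (g v))"
proof -
  have "eff A (\<lambda>v. f v \<in> set (rec_list [[]] (\<lambda>x _ ys. [] # map ((#) x) ys) (g v)))"
    by (intro eff_intros assms)
  moreover have "rec_list [[]] (\<lambda>x _ ys. [] # map ((#) x) ys) xs = prefixes xs" for xs :: "'b list"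
    by (induction xs) simp_all
  ultimately show ?thesis by simp
qed

section \<open>Finite derivations of computations\<close>

text \<open>
  A triple \<open>(n, x, y)\<close> asserts that the functional with number \<open>n\<close> maps \<open>x\<close> to \<open>y\<close>. In a derivation
  every triple follows from later ones by a rule of \<^const>\<open>eval\<close>; the number 4 is \<^const>\<open>Query\<close>, and
  oracle answers are unconstrained except for being 0 or 1.
\<close>

definition justified :: "(nat \<times> nat \<times> nat) list \<Rightarrow> nat \<times> nat \<times> nat \<Rightarrow> bool" where
  "justified d t = (case t of (n, x, y) \<Rightarrow>
     if n = 0 then y = 0
     else if n = 1 then y = Suc x
     else if n = 2 then y = fst (prod_decode x)
     else if n = 3 then y = snd (prod_decode x)
     else if n = 4 then y \<le> 1
     else let q = (n - 5) div 4; r = (n - 5) mod 4; k = fst (prod_decode q); l = snd (prod_decode q) in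
       if r = 0 then (k, x, fst (prod_decode y)) \<in> set d \<and> (l, x, snd (prod_decode y)) \<in> set d
       else if r = 1 then list_ex (\<lambda>t. fst t = l \<and> fst (snd t) = x \<and> (k, snd (snd t), y) \<in> set d) d
       else if r = 2 then
         (case snd (prod_decode x) of
            0 \<Rightarrow> (k, fst (prod_decode x), y) \<in> set d
          | Suc i \<Rightarrow> list_ex (\<lambda>t. fst t = n \<and> fst (snd t) = prod_encode (fst (prod_decode x), i) \<and>
              (l, prod_encode (fst (prod_decode x), prod_encode (i, snd (snd t))), y) \<in> set d) d)
       else (q, prod_encode (x, y), 0) \<in> set d \<and>
         list_all (\<lambda>m. list_ex (\<lambda>t. fst t = q \<and> fst (snd t) = prod_encode (x, m) \<and> snd (snd t) > 0) d) [0..<y])"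

primrec derivation :: "(nat \<times> nat \<times> nat) list \<Rightarrow> bool" where
  "derivation [] \<longleftrightarrow> True"
| "derivation (t # d) \<longleftrightarrow> justified d t \<and> derivation d"

text \<open>Kept apart from \<open>derivation\<close>, so that derivations can be checked without
  the oracle and the same derivation can be held against different oracles.\<close>

definition answers_from :: "nat set \<Rightarrow> (nat \<times> nat \<times> nat) list \<Rightarrow> bool" where
  "answers_from A d \<longleftrightarrow> (\<forall>z b. (4, z, b) \<in> set d \<longrightarrow> b = of_bool (z \<in> A))"

lemma eff_derivation [eff_intros]:
  assumes "eff A f"
  shows "eff A (\<lambda>v. derivation (f v))"
proof -
  have "eff A (\<lambda>v. rec_list True (\<lambda>t d b. justified d t \<and> b) (f v))"
    unfolding justified_def by (intro eff_intros assms)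
  moreover have "rec_list True (\<lambda>t d b. justified d t \<and> b) d = derivation d" for d
    by (induction d) simp_all
  ultimately show ?thesis by simp
qed

lemma justified_basic [simp]:
  "justified d (0, x, y) \<longleftrightarrow> y = 0"
  "justified d (Suc 0, x, y) \<longleftrightarrow> y = Suc x"
  "justified d (2, x, y) \<longleftrightarrow> y = fst (prod_decode x)"
  "justified d (3, x, y) \<longleftrightarrow> y = snd (prod_decode x)"
  "justified d (4, x, y) \<longleftrightarrow> y \<le> 1"
  by (simp_all add: justified_def)

text \<open>The remainder \<open>r\<close> names the constructor and \<open>q\<close> codes its
  arguments. The searches through \<open>d\<close> become plain existential statements.\<close>

lemma justified_composite:
  assumes "r < 4"
  shows "justified d (5 + (4 * q + r), x, y) \<longleftrightarrow>
    (let n = 5 + (4 * q + r); k = fst (prod_decode q); l = snd (prod_decode q) in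
       if r = 0 then (k, x, fst (prod_decode y)) \<in> set d \<and> (l, x, snd (prod_decode y)) \<in> set d
       else if r = 1 then \<exists>z. (l, x, z) \<in> set d \<and> (k, z, y) \<in> set d
       else if r = 2 then
         (case snd (prod_decode x) of
            0 \<Rightarrow> (k, fst (prod_decode x), y) \<in> set d
          | Suc i \<Rightarrow> \<exists>z. (n, prod_encode (fst (prod_decode x), i), z) \<in> set d \<and>
              (l, prod_encode (fst (prod_decode x), prod_encode (i, z)), y) \<in> set d)
       else (q, prod_encode (x, y), 0) \<in> set d \<and>
         (\<forall>m<y. \<exists>z>0. (q, prod_encode (x, m), z) \<in> set d))"
proof -
  have n: "5 + (4 * q + r) - 5 = 4 * q + r" by (rule diff_add_inverse)
  have q: "(4 * q + r) div 4 = q" "(4 * q + r) mod 4 = r" using assms by auto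
  have ex: "list_ex P d \<longleftrightarrow> (\<exists>k u z. (k, u, z) \<in> set d \<and> P (k, u, z))" for P
    by (auto simp: list_ex_iff Bex_def)
  have basic: "5 + (4 * q + r) \<noteq> i" if "i < 5" for i
    using that by simp
  show ?thesis
    unfolding justified_def prod.case n q Let_def ex list_all_iff
    by (simp add: basic[of 0, simplified] basic[of 1] basic[of 2] basic[of 3] basic[of 4] Ball_def conj_commute
        del: add_eq_if add_Suc_right split: nat.split)
qed

lemma justified_Pairing:
  "justified d (functional_encode (Pairing f g), x, y) \<longleftrightarrow>
     (functional_encode f, x, fst (prod_decode y)) \<in> set d \<and>
     (functional_encode g, x, snd (prod_decode y)) \<in> set d"
  using justified_composite[of 0 d "prod_encode (functional_encode f, functional_encode g)" x y]
  by (simp add: Let_def)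

lemma justified_Comp:
  "justified d (functional_encode (Comp f g), x, y) \<longleftrightarrow>
     (\<exists>z. (functional_encode g, x, z) \<in> set d \<and> (functional_encode f, z, y) \<in> set d)"
  unfolding functional_encode.simps by (subst justified_composite) (simp_all add: Let_def)

lemma justified_PrimRec_0:
  "justified d (functional_encode (PrimRec f g), prod_encode (a, 0), y) \<longleftrightarrow>
     (functional_encode f, a, y) \<in> set d"
  unfolding functional_encode.simps by (subst justified_composite) (simp_all add: Let_def)

lemma justified_PrimRec_Suc:
  "justified d (functional_encode (PrimRec f g), prod_encode (a, Suc i), y) \<longleftrightarrow>
     (\<exists>z. (functional_encode (PrimRec f g), prod_encode (a, i), z) \<in> set d \<and>
       (functional_encode g, prod_encode (a, prod_encode (i, z)), y) \<in> set d)"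
  unfolding functional_encode.simps by (subst justified_composite) (simp_all add: Let_def)

lemma justified_Mu:
  "justified d (functional_encode (Mu f), x, y) \<longleftrightarrow>
     (functional_encode f, prod_encode (x, y), 0) \<in> set d \<and>
     (\<forall>m<y. \<exists>z>0. (functional_encode f, prod_encode (x, m), z) \<in> set d)"
  unfolding functional_encode.simps by (subst justified_composite) (simp_all add: Let_def)

lemmas justified_simps = justified_Pairing justified_Comp justified_PrimRec_0
  justified_PrimRec_Suc justified_Mu

text \<open>Later triples are sound by induction, so the first one follows by the rule of
  \<open>eval\<close> that justifies it; an oracle query is the one case that rests on
  \<open>answers_from\<close>.\<close>

lemma derivation_sound:
  assumes "derivation d" "answers_from A d" "(functional_encode F, x, y) \<in> set d"
  shows "eval A F x y"
  using assms
proof (induction d arbitrary: F x y)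
  case (Cons t d)
  have ans: "answers_from A d"
    using Cons.prems(2) by (auto simp: answers_from_def)
  have IH: "eval A F x y" if "(functional_encode F, x, y) \<in> set d" for F x y
    using Cons.IH[OF _ ans that] Cons.prems(1) by simp
  show ?case
  proof (cases "t = (functional_encode F, x, y)")
    case False
    then show ?thesis using Cons.prems(3) IH by simp
  next
    case True
    then have j: "justified d (functional_encode F, x, y)"
      using Cons.prems(1) by simp
    show ?thesis
    proof (cases F)
      case Query
      then show ?thesis using True Cons.prems(2) eval_Query[of A x]
        by (auto simp: answers_from_def)
    next
      case (Pairing f g)
      then show ?thesis
        using j IH eval_Pairing[of A f x "fst (prod_decode y)" g "snd (prod_decode y)"]
        by (simp add: justified_simps del: functional_encode.simps)
    next
      case (Comp f g)
      then show ?thesis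
        using j IH by (auto simp: justified_simps simp del: functional_encode.simps intro: eval_Comp)
    next
      case (PrimRec f g)
      obtain a i where x: "x = prod_encode (a, i)"
        by (metis prod_decode_inverse surj_pair)
      show ?thesis
        using j IH unfolding PrimRec x
        by (cases i) (auto simp: justified_simps simp del: functional_encode.simps
            intro: eval_PrimRec_0 eval_PrimRec_Suc)
    next
      case (Mu f)
      then show ?thesis
        using j IH unfolding Mu justified_Mu by (intro eval_Mu) blast+
    qed (use j in \<open>auto intro: eval.intros\<close>)
  qed
qed simp

text \<open>Every number codes a functional, so the equations for the constructors cover all
  triples, and in them membership in \<open>d\<close> occurs only positively.\<close>

lemma justified_mono:
  assumes "justified d t" "set d \<subseteq> set d'"
  shows "justified d' t"
proof -
  obtain F x y where t: "t = (functional_encode F, x, y)"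
    by (metis prod_cases3 surjD[OF surj_functional_encode])
  show ?thesis
  proof (cases F)
    case (PrimRec f g)
    obtain a i where x: "x = prod_encode (a, i)"
      by (metis prod_decode_inverse surj_pair)
    show ?thesis using assms unfolding t PrimRec x
      by (cases i) (auto simp: justified_simps simp del: functional_encode.simps)
  next
    case (Mu f)
    show ?thesis using assms unfolding t Mu
      by (auto simp: justified_simps simp del: functional_encode.simps) blast
  qed (use assms t in \<open>auto simp: justified_Pairing justified_Comp
      simp del: functional_encode.simps(6-9)\<close>)
qed

lemma derivation_append: "derivation d \<Longrightarrow> derivation d' \<Longrightarrow> derivation (d @ d')"
  by (induction d) (auto intro: justified_mono)

lemma answers_from_append [simp]:
  "answers_from A (d @ d') \<longleftrightarrow> answers_from A d \<and> answers_from A d'"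
  by (auto simp: answers_from_def)

definition derivable :: "nat set \<Rightarrow> nat \<times> nat \<times> nat \<Rightarrow> bool" where
  "derivable A t \<longleftrightarrow> (\<exists>d. derivation d \<and> answers_from A d \<and> t \<in> set d)"

text \<open>Derivations can be concatenated, because surplus triples never invalidate a
  justification.\<close>

lemma finite_derivation:
  assumes "finite T" "\<And>t. t \<in> T \<Longrightarrow> derivable A t"
  obtains d where "derivation d" "answers_from A d" "T \<subseteq> set d"
proof -
  have "\<exists>d. derivation d \<and> answers_from A d \<and> T \<subseteq> set d"
    using assms
  proof (induction T)
    case empty
    show ?case by (rule exI[of _ "[]"]) (simp add: answers_from_def)
  next
    case (insert t T)
    then obtain d d' where "derivation d" "answers_from A d" "T \<subseteq> set d"
      "derivation d'" "answers_from A d'" "t \<in> set d'"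
      unfolding derivable_def by (metis insertCI)
    then show ?case
      by (intro exI[of _ "d @ d'"]) (auto intro: derivation_append)
  qed
  then show ?thesis using that by blast
qed

lemma derivable_step:
  assumes "finite T" "\<And>t. t \<in> T \<Longrightarrow> derivable A t"
    and "\<And>d. T \<subseteq> set d \<Longrightarrow> justified d t"
    and "\<And>z b. t = (4, z, b) \<Longrightarrow> b = of_bool (z \<in> A)"
  shows "derivable A t"
proof -
  obtain d where "derivation d" "answers_from A d" "T \<subseteq> set d"
    using finite_derivation[OF assms(1,2)] .
  then show ?thesis unfolding derivable_def using assms(3)[of d] assms(4)
    by (intro exI[of _ "t # d"]) (auto simp: answers_from_def)
qed

lemma functional_encode_eq_4: "functional_encode F = 4 \<longleftrightarrow> F = Query"
  using injD[OF inj_functional_encode, of F Query] by auto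

lemma derivation_complete: "eval A F x y \<Longrightarrow> derivable A (functional_encode F, x, y)"
proof (induction rule: eval.induct)
  case (eval_Pairing f x y g z)
  show ?case
    by (rule derivable_step[of "{(functional_encode f, x, y), (functional_encode g, x, z)}"])
      (use eval_Pairing in \<open>auto simp: justified_simps functional_encode_eq_4
        simp del: functional_encode.simps\<close>)
next
  case (eval_Comp g x y f z)
  show ?case
    by (rule derivable_step[of "{(functional_encode g, x, y), (functional_encode f, y, z)}"])
      (use eval_Comp in \<open>auto simp: justified_simps functional_encode_eq_4
        simp del: functional_encode.simps\<close>)
next
  case (eval_PrimRec_0 f a y g)
  show ?case
    by (rule derivable_step[of "{(functional_encode f, a, y)}"])
      (use eval_PrimRec_0 in \<open>auto simp: justified_simps functional_encode_eq_4
        simp del: functional_encode.simps\<close>)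
next
  case (eval_PrimRec_Suc f g a n y z)
  show ?case
    by (rule derivable_step[of "{(functional_encode (PrimRec f g), prod_encode (a, n), y),
        (functional_encode g, prod_encode (a, prod_encode (n, y)), z)}"])
      (use eval_PrimRec_Suc in \<open>auto simp: justified_simps functional_encode_eq_4
        simp del: functional_encode.simps\<close>)
next
  case (eval_Mu f a n)
  \<comment> \<open>The positive values that the search passes over. There are finitely many of
    them, so a single derivation can contain them all.\<close>
  then obtain w where w: "\<And>m. m < n \<Longrightarrow> w m > 0 \<and> derivable A (functional_encode f, prod_encode (a, m), w m)"
    by metis
  show ?case
  proof (rule derivable_step[of "insert (functional_encode f, prod_encode (a, n), 0)
      ((\<lambda>m. (functional_encode f, prod_encode (a, m), w m)) ` {..<n})"])
    fix d
    assume "insert (functional_encode f, prod_encode (a, n), 0)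
      ((\<lambda>m. (functional_encode f, prod_encode (a, m), w m)) ` {..<n}) \<subseteq> set d"
    then show "justified d (functional_encode (Mu f), a, n)"
      using w unfolding justified_Mu by blast
  qed (use eval_Mu w in auto)
qed (rule derivable_step[of "{}"]; simp)+

section \<open>Reducibilities\<close>

lemma \<Psi>_functional_encode [simp]: "\<Psi> (functional_encode F) = F"
  by (simp add: \<Psi>_def inj_functional_encode)

lemma functional_encode_\<Psi> [simp]: "functional_encode (\<Psi> e) = e"
  by (simp add: \<Psi>_def surj_functional_encode surj_f_inv_f)

lemma turing_reducible_iff_eff: "A \<le>\<^sub>T B \<longleftrightarrow> eff B (\<lambda>x. x \<in> A)"
proof
  assume "A \<le>\<^sub>T B"
  then have "total_in B (\<lambda>x. of_bool (x \<in> A))"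
    unfolding turing_reducible_def total_in_def by blast
  then show "eff B (\<lambda>x. x \<in> A)" by (rule effI) simp
next
  assume "eff B (\<lambda>x. x \<in> A)"
  then obtain g F where "\<forall>x. g (enc x) = enc (x \<in> A)" "\<forall>n. eval B F n (g n)"
    unfolding eff_def total_in_def by blast
  then have "\<And>x. eval B F x (of_bool (x \<in> A))" by simp
  then show "A \<le>\<^sub>T B"
    unfolding turing_reducible_def by (metis \<Psi>_functional_encode)
qed

text \<open>Serves transitivity: \<open>G\<close> stands for a reduction that answers the oracle
  queries.\<close>

primrec replace_query :: "functional \<Rightarrow> functional \<Rightarrow> functional" where
  "replace_query G Zero = Zero"
| "replace_query G Succ = Succ"
| "replace_query G Proj1 = Proj1"
| "replace_query G Proj2 = Proj2"
| "replace_query G Query = G"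
| "replace_query G (Pairing f g) = Pairing (replace_query G f) (replace_query G g)"
| "replace_query G (Comp f g) = Comp (replace_query G f) (replace_query G g)"
| "replace_query G (PrimRec f g) = PrimRec (replace_query G f) (replace_query G g)"
| "replace_query G (Mu f) = Mu (replace_query G f)"

lemma eval_replace_query:
  assumes "eval B F x y" and G: "\<And>z. eval C G z (of_bool (z \<in> B))"
  shows "eval C (replace_query G F) x y"
  using assms(1)
proof (induction rule: eval.induct)
  case (eval_Mu f a n)
  then show ?case by (auto intro!: eval.eval_Mu)
next
  case (eval_Query x)
  then show ?case unfolding replace_query.simps by (rule G)
qed (auto intro: eval.intros)

lemma turing_reducible_trans:
  assumes "A \<le>\<^sub>T B" "B \<le>\<^sub>T C"
  shows "A \<le>\<^sub>T C"
proof -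
  obtain F where F: "\<And>x. eval B F x (of_bool (x \<in> A))"
    using assms(1) unfolding turing_reducible_def by blast
  obtain G where G: "\<And>x. eval C G x (of_bool (x \<in> B))"
    using assms(2) unfolding turing_reducible_def by blast
  have "eval C (replace_query G F) x (of_bool (x \<in> A))" for x
    using eval_replace_query[OF F G] .
  then show ?thesis
    unfolding turing_reducible_def by (metis \<Psi>_functional_encode)
qed

text \<open>Composition with a constant turns a computation on \<open>x\<close> into a functional
  that ignores its input and whose code is computable from \<open>x\<close>.\<close>

primrec const_functional :: "nat \<Rightarrow> functional" where
  "const_functional 0 = Zero"
| "const_functional (Suc n) = Comp Succ (const_functional n)"

lemma eval_const_functional: "eval A (const_functional n) x n"
  by (induction n) (auto intro: eval.intros)

lemma functional_encode_const_functional: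
  "functional_encode (const_functional n) =
    rec_nat 0 (\<lambda>_ m. 5 + (4 * prod_encode (1, m) + 1)) n"
  by (induction n) simp_all

text \<open>A many-one reduction: \<open>x\<close> is sent to an index of the functional that
  ignores its input and searches for an \<open>s\<close> with \<open>R x s\<close>.\<close>

lemma ce_reducible_halting_set:
  fixes R :: "nat \<Rightarrow> nat \<Rightarrow> bool"
  assumes "eff {} (\<lambda>p. R (fst p) (snd p))"
  shows "{x. \<exists>s. R x s} \<le>\<^sub>T halting_set"
proof -
  \<comment> \<open>The value 0 stands for success, because \<open>Mu\<close> searches for a
    zero.\<close>
  have "eff {} (\<lambda>p. if R (fst p) (snd p) then 0 else 1 :: nat)"
    by (intro eff_intros assms)
  then obtain F where F: "\<And>x s. eval {} F (prod_encode (x, s)) (if R x s then 0 else 1)"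
    unfolding eff_def total_in_def by (metis enc_nat_def enc_prod_def fst_conv snd_conv)
  have Mu: "(\<exists>y. eval {} (Mu F) x y) \<longleftrightarrow> (\<exists>s. R x s)" for x
  proof
    assume "\<exists>y. eval {} (Mu F) x y"
    then obtain y where "eval {} F (prod_encode (x, y)) 0"
      by (auto elim: eval_MuE)
    from eval_deterministic[OF this F] show "\<exists>s. R x s"
      by (metis zero_neq_one)
  next
    assume "\<exists>s. R x s"
    then have s: "R x (LEAST s. R x s)" by (rule LeastI_ex)
    have "eval {} (Mu F) x (LEAST s. R x s)"
    proof (rule eval_Mu)
      show "eval {} F (prod_encode (x, LEAST s. R x s)) 0"
        using F[of x "LEAST s. R x s"] s by simp
      show "\<forall>m<LEAST s. R x s. \<exists>y>0. eval {} F (prod_encode (x, m)) y"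
        using F[of x] not_less_Least[of _ "R x"] by (metis zero_less_one)
    qed
    then show "\<exists>y. eval {} (Mu F) x y" ..
  qed
  define h where "h x = functional_encode (Comp (Mu F) (const_functional x))" for x
  have "h x \<in> halting_set \<longleftrightarrow> (\<exists>y. eval {} (Mu F) x y)" for x
    unfolding h_def halting_set_def mem_Collect_eq \<Psi>_functional_encode
    by (metis eval_Comp eval_CompE eval_const_functional eval_deterministic)
  moreover have "eff halting_set h"
    unfolding h_def functional_encode.simps functional_encode_const_functional
    by (intro eff_intros)
  ultimately show ?thesis
    unfolding turing_reducible_iff_eff using eff_member[of halting_set h] by (simp add: Mu)
qed

section \<open>The stages of the construction\<close>

text \<open>Claims about positions beyond the end are false, so a true \<open>entry\<close> stays
  true when the list is extended.\<close>

definition entry :: "'a list \<Rightarrow> nat \<Rightarrow> 'a \<Rightarrow> bool" where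
  "entry xs i y \<longleftrightarrow> i < length xs \<and> xs ! i = y"

lemma entry_prefix: "entry xs i y \<Longrightarrow> prefix xs ys \<Longrightarrow> entry ys i y"
  by (auto simp: entry_def prefix_def nth_append)

lemma eff_entry [eff_intros]:
  assumes "eff A xs" "eff A i" "eff A y"
  shows "eff A (\<lambda>v. entry (xs v) (i v) (y v))"
proof -
  let ?drop = "\<lambda>xs. rec_nat xs (\<lambda>_ ys. case ys of [] \<Rightarrow> [] | _ # zs \<Rightarrow> zs)"
  have "eff A (\<lambda>v. case ?drop (xs v) (i v) of [] \<Rightarrow> False | z # _ \<Rightarrow> z = y v)"
    by (intro eff_intros assms, rule eff_comp[OF assms(3)], intro eff_intros)
  moreover have "?drop xs i = drop i xs" for xs :: "'b list" and i
  proof (induction i)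
    case (Suc i)
    have "drop (Suc i) xs = tl (drop i xs)" by (simp add: drop_Suc tl_drop)
    then show ?case using Suc by (cases "drop i xs") simp_all
  qed simp
  moreover have "(case drop i xs of [] \<Rightarrow> False | z # _ \<Rightarrow> z = y) = entry xs i y" for xs :: "'b list" and i y
    by (cases "i < length xs") (simp_all add: entry_def flip: Cons_nth_drop_Suc)
  ultimately show ?thesis by simp
qed

primrec pick :: "'a \<Rightarrow> ('a \<Rightarrow> bool) \<Rightarrow> 'a list \<Rightarrow> 'a" where
  "pick d P [] = d"
| "pick d P (x # xs) = (if P x then x else pick d P xs)"

lemma pick_in: "x \<in> set xs \<Longrightarrow> P x \<Longrightarrow> pick d P xs \<in> set xs \<and> P (pick d P xs)"
  by (induction xs) auto

lemma eff_pick [eff_intros]: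
  assumes "eff A (\<lambda>p. g (fst p) (snd p))" "eff A xs"
  shows "eff A (\<lambda>v. pick d (g v) (xs v))"
proof -
  have "eff A (\<lambda>v. rec_list d (\<lambda>x _ y. if g v x then x else y) (xs v))"
    by (intro eff_intros assms eff_comp2[OF assms(1)])
  moreover have "rec_list d (\<lambda>x _ y. if P x then x else y) xs = pick d P xs" for P xs
    by (induction xs) simp_all
  ultimately show ?thesis by simp
qed

definition decode_triples :: "nat \<Rightarrow> (nat \<times> nat \<times> nat) list" where
  "decode_triples n =
    map (\<lambda>z. (fst (prod_decode z), prod_decode (snd (prod_decode z)))) (list_decode n)"

lemma decode_triples_enc [simp]: "decode_triples (enc d) = d"
  by (simp add: decode_triples_def enc_list_def comp_def)

lemma eff_decode_triples [eff_intros]: "eff A f \<Longrightarrow> eff A (\<lambda>v. decode_triples (f v))"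
  unfolding decode_triples_def by (intro eff_intros)

text \<open>
  A level of the tree consists of its nodes, the stage of its creation, and the requirements it has
  met. A node is a pair \<open>(\<pi>, \<sigma>)\<close>: the string \<open>\<pi>\<close> it started from, which serves as its name, and the
  extension \<open>\<sigma>\<close> of \<open>\<pi>\<close> to which it has been moved meanwhile. In a list of levels the last element
  is the root level.
\<close>

type_synonym level = "(bool list \<times> bool list) list \<times> nat \<times> nat list"

text \<open>The sets extending some tip form the current clopen approximation of the class; before
  the first level this is the whole space.\<close>

definition tips :: "level list \<Rightarrow> bool list list" where
  "tips st = (case st of [] \<Rightarrow> [[]] | L # _ \<Rightarrow> map snd (fst L))"

text \<open>
  A requirement \<open>q\<close> codes a number \<open>e\<close> and a list \<open>ps\<close> of names of nodes. If \<open>ps\<close> is empty, \<open>d\<close> has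
  to show that the set computed by \<open>e\<close> does not extend \<open>\<rho>\<close>. Otherwise it has to show that \<open>e\<close> maps
  the witness \<open>x\<close> to 0, where the answers concerning the columns named \<open>\<pi>\<close> are those of \<open>\<rho>\<close>.
\<close>

definition supports :: "nat \<Rightarrow> nat \<Rightarrow> (nat \<times> nat \<times> nat) list \<Rightarrow> bool list \<Rightarrow> bool list \<Rightarrow> bool" where
  "supports q x d \<pi> \<rho> = (let e = fst (prod_decode q); ps = list_decode (snd (prod_decode q)) in
     if ps = [] then
       list_all (\<lambda>t. fst t = 4 \<longrightarrow> snd (snd t) = 0) d \<and>
       list_ex (\<lambda>t. fst t = e \<and> entry \<rho> (fst (snd t)) (snd (snd t) \<noteq> 1)) d
     else
       (e, x, 0) \<in> set d \<and>
       list_all (\<lambda>t. fst t = 4 \<and> entry ps (fst (snd t) mod length ps) (enc \<pi>) \<longrightarrow>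
         entry \<rho> (fst (snd t) div length ps) (snd (snd t) = 1)) d)"

definition allowed :: "nat \<Rightarrow> level \<Rightarrow> nat \<Rightarrow> bool" where
  "allowed k L q = (let ps = list_decode (snd (prod_decode q)) in
     fst (prod_decode q) \<le> k \<and> length ps \<le> k \<and>
     list_all (\<lambda>i. i \<in> set (map (\<lambda>\<nu>. enc (fst \<nu>)) (fst L))) ps)"

text \<open>No two levels are created at the same stage. Pairing with the creation stage therefore
  keeps the witness fixed under moves and apart from those of discarded levels.\<close>

definition witness :: "level \<Rightarrow> nat \<Rightarrow> nat" where
  "witness L q = prod_encode (q, fst (snd L))"

text \<open>The number \<open>p\<close> packs a requirement with a candidate derivation, so that
  opportunities are found by searching through numbers. Each node may choose its own tip, but one
  derivation has to serve all of them.\<close>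

definition enabled :: "nat \<Rightarrow> bool list list \<Rightarrow> level \<Rightarrow> nat \<Rightarrow> bool" where
  "enabled k ts L p = (let q = fst (prod_decode p); d = decode_triples (snd (prod_decode p)) in
     q \<notin> set (snd (snd L)) \<and> allowed k L q \<and> derivation d \<and>
     list_all (\<lambda>\<nu>. list_ex (\<lambda>\<rho>. prefix (snd \<nu>) \<rho> \<and> supports q (witness L q) d (fst \<nu>) \<rho>) ts) (fst L))"

text \<open>For an enabled \<open>p\<close> every node has a suitable tip, so the default
  \<open>[]\<close> is not reached.\<close>

definition move :: "bool list list \<Rightarrow> level \<Rightarrow> nat \<Rightarrow> level" where
  "move ts L p = (let q = fst (prod_decode p); d = decode_triples (snd (prod_decode p)) in
     (map (\<lambda>\<nu>. (fst \<nu>, pick [] (\<lambda>\<rho>. prefix (snd \<nu>) \<rho> \<and> supports q (witness L q) d (fst \<nu>) \<rho>) ts)) (fst L),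
      fst (snd L), q # snd (snd L)))"

text \<open>The value \<open>[]\<close> signals that no level requires attention.\<close>

primrec act :: "bool list list \<Rightarrow> nat \<Rightarrow> level list \<Rightarrow> level list" where
  "act ts s [] = []"
| "act ts s (L # st) =
    (if act ts s st \<noteq> [] then act ts s st
     else if list_ex (enabled (length st) ts L) [0..<s]
     then move ts L (pick 0 (enabled (length st) ts L) [0..<s]) # st
     else [])"

definition sprout :: "bool list list \<Rightarrow> (bool list \<times> bool list) list" where
  "sprout ts = concat (map (\<lambda>\<rho>. [(\<rho> @ [False], \<rho> @ [False]), (\<rho> @ [True], \<rho> @ [True])]) ts)"

definition step :: "nat \<Rightarrow> level list \<Rightarrow> level list" where
  "step s st = (let r = act (tips st) s st in
     if r \<noteq> [] then r else (sprout (tips st), Suc s, []) # st)"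

primrec state :: "nat \<Rightarrow> level list" where
  "state 0 = []"
| "state (Suc s) = step s (state s)"

section \<open>Computability of the construction\<close>

lemma eff_tips [eff_intros]: "eff A f \<Longrightarrow> eff A (\<lambda>v. tips (f v))"
  unfolding tips_def by (intro eff_intros)

lemma eff_supports:
  "eff A (\<lambda>p. supports (fst p) (fst (snd p)) (fst (snd (snd p))) (fst (snd (snd (snd p)))) (snd (snd (snd (snd p)))))"
  unfolding supports_def by (intro eff_intros)

lemma eff_supports' [eff_intros]:
  assumes "eff A a" "eff A b" "eff A c" "eff A d" "eff A e"
  shows "eff A (\<lambda>v. supports (a v) (b v) (c v) (d v) (e v))"
  using eff_comp[OF eff_supports, of A "\<lambda>v. (a v, b v, c v, d v, e v)"]
  by (simp add: assms eff_Pair)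

lemma eff_witness [eff_intros]: "eff A f \<Longrightarrow> eff A g \<Longrightarrow> eff A (\<lambda>v. witness (f v) (g v))"
  unfolding witness_def by (intro eff_intros)

lemma eff_allowed:
  "eff A (\<lambda>p. allowed (fst p) (fst (snd p)) (snd (snd p)))"
  unfolding allowed_def by (intro eff_intros)

lemmas eff_allowed' [eff_intros] = eff_comp3[OF eff_allowed]

lemma eff_enabled:
  "eff A (\<lambda>p. enabled (fst p) (fst (snd p)) (fst (snd (snd p))) (snd (snd (snd p))))"
  unfolding enabled_def by (intro eff_intros)

lemma eff_enabled' [eff_intros]:
  assumes "eff A a" "eff A b" "eff A c" "eff A d"
  shows "eff A (\<lambda>v. enabled (a v) (b v) (c v) (d v))"
  using eff_comp[OF eff_enabled, of A "\<lambda>v. (a v, b v, c v, d v)"]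
  by (simp add: assms eff_Pair)

lemma eff_move:
  "eff A (\<lambda>p. move (fst p) (fst (snd p)) (snd (snd p)))"
  unfolding move_def by (intro eff_intros)

lemmas eff_move' [eff_intros] = eff_comp3[OF eff_move]

lemma eff_act: "eff A (\<lambda>p. act (fst p) (fst (snd p)) (snd (snd p)))"
proof -
  have "eff A (\<lambda>p. rec_list [] (\<lambda>L st r. if r \<noteq> [] then r
     else if list_ex (enabled (length st) (fst p) L) [0..<fst (snd p)]
     then move (fst p) L (pick 0 (enabled (length st) (fst p) L) [0..<fst (snd p)]) # st
     else []) (snd (snd p)))"
    by (intro eff_intros)
  moreover have "rec_list [] (\<lambda>L st r. if r \<noteq> [] then r
     else if list_ex (enabled (length st) ts L) [0..<s]
     then move ts L (pick 0 (enabled (length st) ts L) [0..<s]) # st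
     else []) st = act ts s st" for ts s st
    by (induction st) simp_all
  ultimately show ?thesis by simp
qed

lemmas eff_act' [eff_intros] = eff_comp3[OF eff_act]

lemma eff_step: "eff A (\<lambda>p. step (fst p) (snd p))"
  unfolding step_def sprout_def by (intro eff_intros)

lemmas eff_step' [eff_intros] = eff_comp2[OF eff_step]

lemma eff_state [eff_intros]:
  assumes "eff A f"
  shows "eff A (\<lambda>v. state (f v))"
proof -
  have "eff A (\<lambda>v. rec_nat [] step (f v))"
    by (intro eff_intros assms)
  moreover have "rec_nat [] step s = state s" for s
    by (induction s) simp_all
  ultimately show ?thesis by simp
qed

section \<open>Invariants of the states\<close>

declare split_paired_All [simp del] split_paired_Ex [simp del]

text \<open>A suffix \<open>L # rest\<close> singles out the level \<open>L\<close> together with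
  the levels below it, and \<open>length rest\<close> is its height.\<close>

definition none_enabled :: "bool list list \<Rightarrow> nat \<Rightarrow> level list \<Rightarrow> bool" where
  "none_enabled ts s st \<longleftrightarrow> (\<forall>L rest p. suffix (L # rest) st \<longrightarrow> p < s \<longrightarrow> \<not> enabled (length rest) ts L p)"

lemma none_enabled_Nil [simp]: "none_enabled ts s []"
  by (simp add: none_enabled_def)

lemma none_enabled_Cons:
  "none_enabled ts s (L # st) \<longleftrightarrow> (\<forall>p<s. \<not> enabled (length st) ts L p) \<and> none_enabled ts s st"
  unfolding none_enabled_def suffix_Cons by blast

lemma act_cases:
  "act ts s st = [] \<and> none_enabled ts s st \<or>
   (\<exists>L rest p. suffix (L # rest) st \<and> p < s \<and> enabled (length rest) ts L p \<and>
     none_enabled ts s rest \<and> act ts s st = move ts L p # rest)"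
proof (induction st)
  case (Cons L st)
  show ?case
  proof (cases "act ts s st = []")
    case False
    then obtain M rest p where "suffix (M # rest) st" "p < s" "enabled (length rest) ts M p"
      "none_enabled ts s rest" "act ts s st = move ts M p # rest"
      using Cons.IH by blast
    then show ?thesis by (intro disjI2 exI[of _ M] exI[of _ rest] exI[of _ p]) (simp add: suffix_Cons)
  next
    case True
    then have ne: "none_enabled ts s st" using Cons.IH by auto
    show ?thesis
    proof (cases "\<exists>p<s. enabled (length st) ts L p")
      case False
      then show ?thesis using True ne by (auto simp: none_enabled_Cons list_ex_iff)
    next
      case ex: True
      then obtain p where "p \<in> set [0..<s]" "enabled (length st) ts L p" by auto
      from pick_in[of p "[0..<s]" "enabled (length st) ts L", OF this, of 0] show ?thesis
        using True ne ex by (auto simp: list_ex_iff intro!: exI[of _ L] exI[of _ st])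
    qed
  qed
qed simp

lemma step_cases:
  obtains (grow) "none_enabled (tips st) s st" "step s st = (sprout (tips st), Suc s, []) # st"
  | (move) L rest p where "suffix (L # rest) st" "p < s" "enabled (length rest) (tips st) L p"
      "none_enabled (tips st) s rest" "step s st = move (tips st) L p # rest"
  using act_cases[of "tips st" s st] unfolding step_def by (fastforce simp: Let_def)

definition level_ok :: "level \<Rightarrow> bool" where
  "level_ok L \<longleftrightarrow> (\<forall>\<nu>\<in>set (fst L). prefix (fst \<nu>) (snd \<nu>)) \<and> inj_on fst (set (fst L)) \<and>
     (\<forall>q\<in>set (snd (snd L)). \<exists>d. derivation d \<and>
        (\<forall>\<nu>\<in>set (fst L). supports q (witness L q) d (fst \<nu>) (snd \<nu>)))"

primrec coherent :: "level list \<Rightarrow> bool" where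
  "coherent [] \<longleftrightarrow> True"
| "coherent (L # st) \<longleftrightarrow> fst ` set (fst L) = {\<rho> @ [b] | \<rho> b. \<rho> \<in> set (tips st)} \<and>
     level_ok L \<and> coherent st"

lemma coherent_suffix: "coherent st \<Longrightarrow> suffix st' st \<Longrightarrow> coherent st'"
  by (induction st) (auto simp: suffix_Cons)

lemma tips_Nil [simp]: "tips [] = [[]]"
  by (simp add: tips_def)

lemma tips_Cons [simp]: "tips (L # st) = map snd (fst L)"
  by (simp add: tips_def)

text \<open>In \<open>supports\<close> the string \<rho> occurs only in positive
  \<open>entry\<close> claims, and these persist under extension.\<close>

lemma supports_prefix:
  assumes "supports q x d \<pi> \<rho>" "prefix \<rho> \<rho>'"
  shows "supports q x d \<pi> \<rho>'"
  using assms entry_prefix[OF _ assms(2)]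
  by (auto simp: supports_def Let_def list_ex_iff list_all_iff split: if_splits)

lemma set_sprout: "set (sprout ts) = {(\<rho> @ [b], \<rho> @ [b]) | \<rho> b. \<rho> \<in> set ts}"
  by (auto simp: sprout_def)

lemma enabled_move:
  assumes "enabled k ts L p" and "\<nu> \<in> set (fst (move ts L p))"
  obtains \<sigma> where "(fst \<nu>, \<sigma>) \<in> set (fst L)" "prefix \<sigma> (snd \<nu>)" "snd \<nu> \<in> set ts"
    "supports (fst (prod_decode p)) (witness L (fst (prod_decode p)))
       (decode_triples (snd (prod_decode p))) (fst \<nu>) (snd \<nu>)"
proof -
  let ?P = "\<lambda>\<mu> \<rho>. prefix (snd \<mu>) \<rho> \<and> supports (fst (prod_decode p)) (witness L (fst (prod_decode p)))
       (decode_triples (snd (prod_decode p))) (fst \<mu>) \<rho>"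
  obtain \<mu> where \<mu>: "\<mu> \<in> set (fst L)" "\<nu> = (fst \<mu>, pick [] (?P \<mu>) ts)"
    using assms(2) by (auto simp: move_def Let_def)
  obtain \<rho> where "\<rho> \<in> set ts" "?P \<mu> \<rho>"
    using assms(1) \<mu>(1) by (auto simp: enabled_def Let_def list_all_iff list_ex_iff)
  from pick_in[of \<rho> ts "?P \<mu>", OF this, of "[]"] show ?thesis
    using \<mu> that[of "snd \<mu>"] by simp
qed

lemma move_simps [simp]:
  "fst ` set (fst (move ts L p)) = fst ` set (fst L)"
  "fst (snd (move ts L p)) = fst (snd L)"
  "snd (snd (move ts L p)) = fst (prod_decode p) # snd (snd L)"
  "witness (move ts L p) q = witness L q"
  by (simp_all add: move_def Let_def image_image witness_def)

text \<open>The new requirement is met by the derivation inside \<open>p\<close>; older ones keep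
  theirs by \<open>supports_prefix\<close>.\<close>

lemma level_ok_move:
  assumes ok: "level_ok L" and en: "enabled k ts L p"
  shows "level_ok (move ts L p)"
  unfolding level_ok_def
proof (intro conjI ballI)
  fix \<nu> assume "\<nu> \<in> set (fst (move ts L p))"
  then obtain \<sigma> where \<sigma>: "(fst \<nu>, \<sigma>) \<in> set (fst L)" "prefix \<sigma> (snd \<nu>)"
    using enabled_move[OF en] by blast
  have "prefix (fst \<nu>) \<sigma>"
    using ok bspec[OF _ \<sigma>(1), of "\<lambda>\<nu>. prefix (fst \<nu>) (snd \<nu>)"] by (simp add: level_ok_def)
  then show "prefix (fst \<nu>) (snd \<nu>)" using \<sigma>(2) by (rule prefix_order.trans)
next
  show "inj_on fst (set (fst (move ts L p)))"
    using ok by (auto simp: level_ok_def move_def Let_def inj_on_def)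
next
  fix q assume q: "q \<in> set (snd (snd (move ts L p)))"
  show "\<exists>d. derivation d \<and> (\<forall>\<nu>\<in>set (fst (move ts L p)).
      supports q (witness (move ts L p) q) d (fst \<nu>) (snd \<nu>))"
  proof (cases "q = fst (prod_decode p)")
    case True
    have "derivation (decode_triples (snd (prod_decode p)))"
      using en by (simp add: enabled_def Let_def)
    moreover have "supports q (witness (move ts L p) q) (decode_triples (snd (prod_decode p))) (fst \<nu>) (snd \<nu>)"
      if "\<nu> \<in> set (fst (move ts L p))" for \<nu>
      unfolding move_simps True by (rule enabled_move[OF en that])
    ultimately show ?thesis by blast
  next
    case False
    then obtain d where d: "derivation d"
      "\<forall>\<nu>\<in>set (fst L). supports q (witness L q) d (fst \<nu>) (snd \<nu>)"
      using ok q unfolding level_ok_def by auto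
    have "supports q (witness (move ts L p) q) d (fst \<nu>) (snd \<nu>)"
      if \<nu>: "\<nu> \<in> set (fst (move ts L p))" for \<nu>
    proof -
      obtain \<sigma> where "(fst \<nu>, \<sigma>) \<in> set (fst L)" "prefix \<sigma> (snd \<nu>)"
        using enabled_move[OF en \<nu>] by blast
      then show ?thesis
        using bspec[OF d(2), of "(fst \<nu>, \<sigma>)"] by (auto intro: supports_prefix)
    qed
    then show ?thesis using d(1) by blast
  qed
qed

text \<open>A move keeps the names of the level and discards everything above it, so no level
  remains whose names depend on the old tips.\<close>

lemma coherent_step:
  assumes "coherent st"
  shows "coherent (step s st)"
proof (cases rule: step_cases[of st s])
  case grow
  have "level_ok (sprout (tips st), Suc s, [])"
    by (auto simp: level_ok_def set_sprout inj_on_def)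
  moreover have "fst ` set (sprout (tips st)) = {\<rho> @ [b] | \<rho> b. \<rho> \<in> set (tips st)}"
    by (force simp: set_sprout)
  ultimately show ?thesis using grow(2) assms by simp
next
  case (move L rest p)
  then have "coherent (L # rest)" using coherent_suffix[OF assms] by blast
  then show ?thesis using move level_ok_move by simp
qed

lemma coherent_state: "coherent (state s)"
  by (induction s) (simp_all add: coherent_step)

text \<open>Nodes are moved only to current tips, so the approximations of the class
  decrease.\<close>

lemma tips_step:
  assumes "\<rho> \<in> set (tips (step s st))"
  obtains \<sigma> where "\<sigma> \<in> set (tips st)" "prefix \<sigma> \<rho>"
proof (cases rule: step_cases[of st s])
  case grow
  then show ?thesis using assms that by (auto simp: set_sprout)
next
  case (move L rest p)
  then obtain \<nu> where "\<nu> \<in> set (fst (move (tips st) L p))" "\<rho> = snd \<nu>"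
    using assms by auto
  with enabled_move[OF move(3)] show ?thesis using that by blast
qed

lemma tips_state_mono:
  assumes "s \<le> s'" "\<rho> \<in> set (tips (state s'))"
  shows "\<exists>\<sigma>\<in>set (tips (state s)). prefix \<sigma> \<rho>"
  using assms
proof (induction s' arbitrary: \<rho> rule: dec_induct)
  case (step s')
  obtain \<sigma> where "\<sigma> \<in> set (tips (state s'))" "prefix \<sigma> \<rho>"
    using tips_step[of \<rho> s' "state s'"] step.prems by auto
  then show ?case using step.IH by (meson prefix_order.trans)
qed auto

lemma coherent_names:
  assumes "coherent (L # st)"
  shows coherent_parent: "\<nu> \<in> set (fst L) \<Longrightarrow> \<exists>\<rho>\<in>set (tips st). \<exists>b. fst \<nu> = \<rho> @ [b]"
    and coherent_child: "\<rho> \<in> set (tips st) \<Longrightarrow> \<exists>\<nu>\<in>set (fst L). fst \<nu> = \<rho> @ [b]"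
    and coherent_node_prefix: "\<nu> \<in> set (fst L) \<Longrightarrow> prefix (fst \<nu>) (snd \<nu>)"
proof -
  have names: "fst ` set (fst L) = {\<rho> @ [b] | \<rho> b. \<rho> \<in> set (tips st)}"
    and ok: "level_ok L" using assms by simp_all
  show "\<exists>\<rho>\<in>set (tips st). \<exists>b. fst \<nu> = \<rho> @ [b]" if "\<nu> \<in> set (fst L)"
    using imageI[OF that, of fst] unfolding names by blast
  show "\<exists>\<nu>\<in>set (fst L). fst \<nu> = \<rho> @ [b]" if "\<rho> \<in> set (tips st)"
  proof -
    have "\<rho> @ [b] \<in> fst ` set (fst L)" using that unfolding names by blast
    then show ?thesis by (metis imageE)
  qed
  show "prefix (fst \<nu>) (snd \<nu>)" if "\<nu> \<in> set (fst L)"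
    using ok that by (simp add: level_ok_def)
qed

text \<open>Incomparability takes the form that strings with a common extension \<tau> are equal.
  Names below \<tau> have parents below \<tau>; these coincide, and then \<tau> determines the last
  bit.\<close>

lemma coherent_nodes_step:
  assumes "coherent (L # st)"
    and tips: "\<And>\<rho> \<rho>'. \<rho> \<in> set (tips st) \<Longrightarrow> \<rho>' \<in> set (tips st) \<Longrightarrow> prefix \<rho> \<tau> \<Longrightarrow> prefix \<rho>' \<tau> \<Longrightarrow> \<rho> = \<rho>'"
    and \<nu>: "\<nu> \<in> set (fst L)" "\<nu>' \<in> set (fst L)" "prefix (fst \<nu>) \<tau>" "prefix (fst \<nu>') \<tau>"
  shows "\<nu> = \<nu>'"
proof -
  obtain \<rho> b \<rho>' b' where *: "\<rho> \<in> set (tips st)" "fst \<nu> = \<rho> @ [b]"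
    "\<rho>' \<in> set (tips st)" "fst \<nu>' = \<rho>' @ [b']"
    using coherent_parent[OF assms(1)] \<nu>(1,2) by metis
  then have "\<rho> = \<rho>'" using tips \<nu>(3,4) append_prefixD by metis
  then have "fst \<nu> = fst \<nu>'"
    using prefix_same_cases[OF \<nu>(3,4)] * by (auto simp: prefix_def)
  then show ?thesis using assms(1) \<nu>(1,2) by (auto simp: level_ok_def dest: inj_onD)
qed

lemma coherent_tips_incomparable:
  assumes "coherent st" "\<rho> \<in> set (tips st)" "\<rho>' \<in> set (tips st)" "prefix \<rho> \<tau>" "prefix \<rho>' \<tau>"
  shows "\<rho> = \<rho>'"
  using assms
proof (induction st arbitrary: \<rho> \<rho>')
  case (Cons L st)
  then obtain \<nu> \<nu>' where \<nu>: "\<nu> \<in> set (fst L)" "\<rho> = snd \<nu>" "\<nu>' \<in> set (fst L)" "\<rho>' = snd \<nu>'" by auto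
  moreover have "prefix (fst \<nu>) \<tau>" "prefix (fst \<nu>') \<tau>"
    using Cons.prems \<nu> by (auto simp: level_ok_def intro: prefix_order.trans)
  moreover have "coherent st" using Cons.prems(1) by simp
  ultimately show ?case
    using coherent_nodes_step[OF Cons.prems(1), of \<tau> \<nu> \<nu>'] Cons.IH by blast
qed simp

lemma coherent_nodes_incomparable:
  assumes "coherent (L # st)" "\<nu> \<in> set (fst L)" "\<nu>' \<in> set (fst L)" "prefix (fst \<nu>) \<tau>" "prefix (fst \<nu>') \<tau>"
  shows "\<nu> = \<nu>'"
  by (rule coherent_nodes_step[OF assms(1) _ assms(2-5)], rule coherent_tips_incomparable) (use assms(1) in auto)

text \<open>Names are successors of the tips below, and every tip has such a successor. The first
  direction later puts paths on settled nodes; the second shows that no settled node is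
  abandoned.\<close>

lemma coherent_tips_suffix:
  assumes "coherent st" "suffix st' st"
  shows "\<rho> \<in> set (tips st) \<Longrightarrow> \<exists>\<sigma>\<in>set (tips st'). prefix \<sigma> \<rho>"
    and "\<sigma> \<in> set (tips st') \<Longrightarrow> \<exists>\<rho>\<in>set (tips st). prefix \<sigma> \<rho>"
proof -
  have "(\<forall>\<rho>\<in>set (tips st). \<exists>\<sigma>\<in>set (tips st'). prefix \<sigma> \<rho>) \<and>
    (\<forall>\<sigma>\<in>set (tips st'). \<exists>\<rho>\<in>set (tips st). prefix \<sigma> \<rho>)"
    using assms
  proof (induction st)
    case (Cons L st)
    show ?case
    proof (cases "st' = L # st")
      case False
      then have IH: "\<forall>\<rho>\<in>set (tips st). \<exists>\<sigma>\<in>set (tips st'). prefix \<sigma> \<rho>"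
        "\<forall>\<sigma>\<in>set (tips st'). \<exists>\<rho>\<in>set (tips st). prefix \<sigma> \<rho>"
        using Cons by (auto simp: suffix_Cons)
      have coh: "coherent (L # st)" by (rule Cons.prems(1))
      have "\<exists>\<sigma>\<in>set (tips st'). prefix \<sigma> (snd \<nu>)" if \<nu>: "\<nu> \<in> set (fst L)" for \<nu>
      proof -
        obtain \<rho> b where \<rho>: "\<rho> \<in> set (tips st)" "fst \<nu> = \<rho> @ [b]"
          using coherent_parent[OF coh \<nu>] by blast
        then have "prefix \<rho> (snd \<nu>)"
          using coherent_node_prefix[OF coh \<nu>] append_prefixD by metis
        then show ?thesis using IH(1) \<rho>(1) by (blast intro: prefix_order.trans)
      qed
      moreover have "\<exists>\<nu>\<in>set (fst L). prefix \<sigma> (snd \<nu>)" if \<sigma>: "\<sigma> \<in> set (tips st')" for \<sigma>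
      proof -
        obtain \<rho> where \<rho>: "\<rho> \<in> set (tips st)" "prefix \<sigma> \<rho>" using IH(2) \<sigma> by blast
        obtain \<nu> where \<nu>: "\<nu> \<in> set (fst L)" "fst \<nu> = \<rho> @ [True]"
          using coherent_child[OF coh \<rho>(1)] by blast
        then have "prefix \<rho> (snd \<nu>)"
          using coherent_node_prefix[OF coh] append_prefixD by metis
        then show ?thesis using \<rho>(2) \<nu>(1) by (blast intro: prefix_order.trans)
      qed
      ultimately show ?thesis by simp
    qed auto
  qed auto
  then show "\<rho> \<in> set (tips st) \<Longrightarrow> \<exists>\<sigma>\<in>set (tips st'). prefix \<sigma> \<rho>"
    and "\<sigma> \<in> set (tips st') \<Longrightarrow> \<exists>\<rho>\<in>set (tips st). prefix \<sigma> \<rho>" by auto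
qed

text \<open>Each level adds at least one bit. This makes names long enough to separate distinct
  members of the class.\<close>

lemma coherent_length:
  assumes "coherent (L # st)" "\<nu> \<in> set (fst L)"
  shows "length st < length (fst \<nu>)"
  using assms
proof (induction st arbitrary: L \<nu>)
  case Nil
  then obtain \<rho> b where "fst \<nu> = \<rho> @ [b]" using coherent_parent[OF Nil.prems] by blast
  then show ?case by simp
next
  case (Cons L' st)
  obtain \<rho> b where \<rho>: "\<rho> \<in> set (tips (L' # st))" "fst \<nu> = \<rho> @ [b]"
    using coherent_parent[OF Cons.prems] by blast
  have "\<rho> \<in> snd ` set (fst L')" using \<rho>(1) by simp
  then obtain \<mu> where \<mu>: "\<mu> \<in> set (fst L')" "\<rho> = snd \<mu>" by blast
  have coh: "coherent (L' # st)" using Cons.prems(1) by simp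
  have "length st < length (snd \<mu>)"
    using Cons.IH[OF coh \<mu>(1)] prefix_length_le[OF coherent_node_prefix[OF coh \<mu>(1)]] by simp
  then show ?case unfolding \<rho>(2) \<mu>(2) by simp
qed

lemma coherent_tips_length:
  assumes "coherent st" "\<rho> \<in> set (tips st)"
  shows "length st \<le> length \<rho>"
proof (cases st)
  case (Cons L rest)
  then obtain \<nu> where \<nu>: "\<nu> \<in> set (fst L)" "\<rho> = snd \<nu>" using assms(2) by auto
  have coh: "coherent (L # rest)" using assms(1) Cons by simp
  show ?thesis
    using coherent_length[OF coh \<nu>(1)] prefix_length_le[OF coherent_node_prefix[OF coh \<nu>(1)]] \<nu>(2) Cons
    by simp
qed simp

text \<open>Higher levels are younger and are listed first, so within a state the creation stage
  identifies the level.\<close>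

lemma state_stages:
  "sorted_wrt (>) (map (\<lambda>L. fst (snd L)) (state s)) \<and> (\<forall>L\<in>set (state s). fst (snd L) \<le> s)"
proof (induction s)
  case (Suc s)
  show ?case
  proof (cases rule: step_cases[of "state s" s])
    case grow
    then show ?thesis using Suc by (auto simp: le_imp_less_Suc le_SucI)
  next
    case (move L rest p)
    then obtain us where "state s = us @ L # rest" by (auto simp: suffix_def)
    then show ?thesis using Suc move(5) by (auto simp: sorted_wrt_append le_SucI)
  qed
qed simp

lemma state_level_unique:
  assumes "L \<in> set (state s)" "L' \<in> set (state s)" "fst (snd L) = fst (snd L')"
  shows "L = L'"
proof -
  have "distinct xs" if "sorted_wrt (>) xs" for xs :: "nat list"
    using that by (induction xs) auto
  then have "distinct (map (\<lambda>L. fst (snd L)) (state s))" using state_stages by blast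
  then show ?thesis using assms unfolding distinct_map by (metis inj_onD)
qed

text \<open>The creation stage also identifies a level across stages, and its moves only add to the
  requirements met.\<close>

lemma done_mono:
  assumes "s \<le> s'" "L \<in> set (state s)" "L' \<in> set (state s')" "fst (snd L) = fst (snd L')"
  shows "set (snd (snd L)) \<subseteq> set (snd (snd L'))"
  using assms
proof (induction s' arbitrary: L' rule: dec_induct)
  case base
  then show ?case using state_level_unique by blast
next
  case (step s')
  \<comment> \<open>The level \<open>L'\<close> is not the one that this step may create, as that
    one would bear the stage \<open>Suc s'\<close>.\<close>
  have le: "fst (snd L') \<le> s'"
    using step.prems(1,3) state_stages[of s] step.hyps(1) by (metis le_trans)
  obtain M where M: "M \<in> set (state s')" "fst (snd M) = fst (snd L')" "set (snd (snd M)) \<subseteq> set (snd (snd L'))"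
  proof (cases rule: step_cases[of "state s'" s'])
    case grow
    then have "L' \<in> set (state s')" using step.prems(2) le by auto
    then show ?thesis using that by blast
  next
    case (move M rest p)
    have sub: "set (M # rest) \<subseteq> set (state s')" by (rule set_mono_suffix[OF move(1)])
    consider "L' = move (tips (state s')) M p" | "L' \<in> set rest"
      using step.prems(2) move(5) by auto
    then show ?thesis
    proof cases
      case 1
      show ?thesis by (rule that[of M]) (use sub in \<open>simp_all add: 1 subset_insertI\<close>)
    next
      case 2
      show ?thesis by (rule that[of L']) (use sub 2 in auto)
    qed
  qed
  then show ?case using step.IH[OF step.prems(1) M(1)] step.prems(3) by simp
qed

section \<open>Every level stabilizes\<close>

text \<open>A level records the current positions of its nodes, so settled levels are neither
  discarded nor moved.\<close>

definition settled :: "nat \<Rightarrow> level list \<Rightarrow> bool" where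
  "settled s0 st \<longleftrightarrow> (\<forall>s\<ge>s0. suffix st (state s))"

lemma settledD: "settled s0 st \<Longrightarrow> s0 \<le> s \<Longrightarrow> suffix st (state s)"
  by (simp add: settled_def)

lemma settled_suffix: "settled s0 st \<Longrightarrow> suffix st' st \<Longrightarrow> settled s0 st'"
  unfolding settled_def by (meson suffix_order.trans)

lemma settled_coherent: "settled s0 st \<Longrightarrow> coherent st"
  unfolding settled_def using coherent_state coherent_suffix by blast

lemma move_neq: "move ts L p \<noteq> L"
  by (metis move_simps(3) not_Cons_self2)

text \<open>A move changes its level, whereas settled levels do not change; so the moved level lies
  above \<open>st\<close>.\<close>

lemma settled_move:
  assumes "settled s0 st" "s0 \<le> s" "suffix (L # rest) (state s)"
    and "state (Suc s) = move ts L p # rest"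
  shows "length st \<le> length rest \<and> suffix st rest"
proof -
  have st: "suffix st (state s)" "suffix st (move ts L p # rest)"
    using assms unfolding settled_def by (metis le_SucI)+
  have "st \<noteq> move ts L p # rest"
  proof
    assume eq: "st = move ts L p # rest"
    have "suffix st (L # rest)"
      using suffix_length_suffix[OF st(1) assms(3)] eq by simp
    then have "st = L # rest" using eq by (metis length_Cons suffix_length_less suffix_order.le_less nat_less_le)
    then show False using eq move_neq by simp
  qed
  then show ?thesis using st(2) by (auto simp: suffix_Cons suffix_length_le)
qed

text \<open>Either nothing is enabled, or a level acts below which nothing is enabled. In the latter
  case the settled levels lie below the acting one.\<close>

lemma settled_not_enabled:
  assumes "settled s0 (L # st)" "s0 \<le> s" "p < s"
  shows "\<not> enabled (length st) (tips (state s)) L p"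
proof (cases rule: step_cases[of "state s" s])
  case grow
  then show ?thesis using assms unfolding settled_def none_enabled_def by blast
next
  case (move M rest p')
  have "suffix (L # st) rest"
    using settled_move[OF assms(1,2) move(1)] move(5) by simp
  then show ?thesis using move(4) assms(3) unfolding none_enabled_def by blast
qed

lemma finite_allowed: "finite {q. allowed k L q}"
proof -
  let ?S = "(\<lambda>\<nu>. enc (fst \<nu>)) ` set (fst L)"
  have "{q. allowed k L q} \<subseteq> (\<lambda>x. prod_encode (fst x, list_encode (snd x))) `
    ({..k} \<times> {ps. set ps \<subseteq> ?S \<and> length ps \<le> k})"
  proof
    fix q assume "q \<in> {q. allowed k L q}"
    then show "q \<in> (\<lambda>x. prod_encode (fst x, list_encode (snd x))) `
      ({..k} \<times> {ps. set ps \<subseteq> ?S \<and> length ps \<le> k})"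
      by (intro image_eqI[of _ _ "(fst (prod_decode q), list_decode (snd (prod_decode q)))"])
        (auto simp: allowed_def Let_def list_all_iff)
  qed
  then show ?thesis
    by (rule finite_subset) (intro finite_imageI finite_cartesian_product finite_lists_length_le finite_atMost finite_set)
qed

lemma allowed_move: "allowed k (move ts L p) = allowed k L"
  by (intro ext) (simp add: allowed_def move_def Let_def comp_def)

lemma settled_exists: "\<exists>s0 st. length st = k \<and> settled s0 st"
proof (induction k)
  case 0
  show ?case by (intro exI[of _ 0] exI[of _ "[]"]) (simp add: settled_def)
next
  case (Suc k)
  then obtain s0 R where R: "length R = k" "settled s0 R" by blast
  \<comment> \<open>From \<open>Suc s0\<close> on some level sits directly above \<open>R\<close>: a
    step either adds a level or moves one above \<open>R\<close>.\<close>
  have "\<exists>L. suffix (L # R) (state (Suc s))" if s: "s \<ge> s0" for s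
  proof -
    have longer: "length R < length (state (Suc s))"
    proof (cases rule: step_cases[of "state s" s])
      case grow
      have "suffix R (state s)" using R(2) s by (simp add: settled_def)
      then have "length R \<le> length (state s)" by (rule suffix_length_le)
      then show ?thesis using grow(2) by simp
    next
      case (move L rest p)
      have "length R \<le> length rest"
        using settled_move[OF R(2) s move(1)] move(5) by simp
      then show ?thesis using move(5) by simp
    qed
    have "suffix R (state (Suc s))" using s by (intro settledD[OF R(2)] le_SucI)
    then obtain us where us: "state (Suc s) = us @ R" by (rule suffixE)
    then have "us \<noteq> []" using longer by auto
    then obtain vs L where "us = vs @ [L]" by (metis rev_exhaust)
    then have "state (Suc s) = vs @ L # R" using us by simp
    then show ?thesis by (blast intro: suffixI)
  qed
  then have "\<exists>L. suffix (L # R) (state s)" if "s > s0" for s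
    using that by (metis less_Suc_eq_le lessE)
  then obtain lev where lev: "\<And>s. s > s0 \<Longrightarrow> suffix (lev s # R) (state s)" by metis
  define open_reqs where "open_reqs s = {q. allowed k (lev s) q} - set (snd (snd (lev s)))" for s
  have unique: "L = lev s" if "suffix (L # R) (state s)" "s > s0" for L s
  proof -
    have "suffix (L # R) (lev s # R)"
      by (rule suffix_length_suffix[OF that(1) lev[OF that(2)]]) simp
    then show ?thesis by (auto simp: suffix_Cons dest: suffix_length_le)
  qed
  \<comment> \<open>The level directly above \<open>R\<close> changes only by its own move, which
    meets a further requirement while the allowed ones remain the same.\<close>
  have drop: "lev (Suc s) = lev s \<or> card (open_reqs (Suc s)) < card (open_reqs s)" if "s > s0" for s
  proof (cases rule: step_cases[of "state s" s])
    case grow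
    then have "suffix (lev s # R) (state (Suc s))" using lev[OF that] by (simp add: suffix_Cons)
    then show ?thesis using unique that by auto
  next
    case (move L rest p)
    then have "suffix R rest" using settled_move[OF R(2) _ move(1)] that by simp
    show ?thesis
    proof (cases "R = rest")
      case True
      then have L: "L = lev s" "lev (Suc s) = move (tips (state s)) L p"
        using unique[of L s] unique[of "move (tips (state s)) L p" "Suc s"] move that by auto
      then have "open_reqs (Suc s) = open_reqs s - {fst (prod_decode p)}"
        by (auto simp: open_reqs_def allowed_move)
      moreover have "fst (prod_decode p) \<in> open_reqs s"
        using move(3) L R(1) True by (auto simp: open_reqs_def enabled_def Let_def)
      moreover have "finite (open_reqs s)" by (simp add: open_reqs_def finite_allowed)
      ultimately show ?thesis by (metis card_Diff1_less)
    next
      case False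
      then obtain us where us: "rest = us @ R" "us \<noteq> []"
        using \<open>suffix R rest\<close> by (auto simp: suffix_def)
      then obtain M vs where "us = vs @ [M]" by (metis rev_exhaust)
      then have M: "suffix (M # R) rest" using us by (simp add: suffix_def)
      then have "suffix (M # R) (L # rest)" by (simp add: suffix_Cons)
      then have "suffix (M # R) (state s)" using move(1) by (rule suffix_order.trans)
      moreover have "suffix (M # R) (state (Suc s))" using M move(5) by (simp add: suffix_Cons)
      ultimately have "M = lev s" "M = lev (Suc s)" using unique that by auto
      then show ?thesis by simp
    qed
  qed
  \<comment> \<open>From a stage with the fewest open requirements on, the level can no longer
    change.\<close>
  define s1 where "s1 = (ARG_MIN (\<lambda>s. card (open_reqs s)) s. s > s0)"
  have s1: "s1 > s0" "\<And>s. s > s0 \<Longrightarrow> card (open_reqs s1) \<le> card (open_reqs s)"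
    unfolding s1_def using arg_min_nat_lemma[of "\<lambda>s. s > s0" "Suc s0" "\<lambda>s. card (open_reqs s)"] by auto
  have "lev s = lev s1" if "s \<ge> s1" for s
    using that
  proof (induction s rule: dec_induct)
    case (step s)
    then have "card (open_reqs (Suc s)) \<ge> card (open_reqs s)"
      using s1 by (simp add: open_reqs_def)
    then show ?case using drop[of s] s1(1) step by auto
  qed simp
  then have "settled s1 (lev s1 # R)"
    unfolding settled_def using lev s1(1) by (metis order_less_le_trans)
  then show ?case using R(1) by (metis length_Cons)
qed

section \<open>The class and the enumerated set\<close>

definition extends :: "nat set \<Rightarrow> bool list \<Rightarrow> bool" where
  "extends A \<sigma> \<longleftrightarrow> (\<forall>i<length \<sigma>. \<sigma> ! i \<longleftrightarrow> i \<in> A)"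

lemma length_initial_segment [simp]: "length (initial_segment A n) = n"
  by (simp add: initial_segment_def)

lemma extends_initial_segment: "extends A (initial_segment A n)"
  by (simp add: extends_def initial_segment_def)

lemma extends_prefix:
  assumes "extends A \<sigma>" "prefix \<tau> \<sigma>"
  shows "extends A \<tau>"
proof -
  obtain \<upsilon> where \<sigma>: "\<sigma> = \<tau> @ \<upsilon>" using assms(2) by (rule prefixE)
  have "\<tau> ! i \<longleftrightarrow> i \<in> A" if "i < length \<tau>" for i
  proof -
    have "i < length \<sigma>" using that \<sigma> by simp
    then have "\<sigma> ! i \<longleftrightarrow> i \<in> A" using assms(1) unfolding extends_def by blast
    then show ?thesis using that \<sigma> by (simp add: nth_append)
  qed
  then show ?thesis by (simp add: extends_def)
qed

lemma extends_iff_prefix: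
  assumes "length \<sigma> \<le> n"
  shows "extends A \<sigma> \<longleftrightarrow> prefix \<sigma> (initial_segment A n)"
proof
  assume "extends A \<sigma>"
  then have "\<sigma> = take (length \<sigma>) (initial_segment A n)"
    using assms by (intro nth_equalityI) (simp_all add: extends_def initial_segment_def)
  then show "prefix \<sigma> (initial_segment A n)" using take_is_prefix by metis
qed (rule extends_prefix[OF extends_initial_segment])

lemma extends_comparable:
  assumes "extends A \<sigma>" "extends A \<tau>"
  obtains \<upsilon> where "prefix \<sigma> \<upsilon>" "prefix \<tau> \<upsilon>" "extends A \<upsilon>"
proof (rule that[of "initial_segment A (max (length \<sigma>) (length \<tau>))"])
  show "prefix \<sigma> (initial_segment A (max (length \<sigma>) (length \<tau>)))"
    using assms(1) by (subst extends_iff_prefix[symmetric]) simp_all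
  show "prefix \<tau> (initial_segment A (max (length \<sigma>) (length \<tau>)))"
    using assms(2) by (subst extends_iff_prefix[symmetric]) simp_all
qed (rule extends_initial_segment)

lemma extends_entry: "extends A \<rho> \<Longrightarrow> entry \<rho> i b \<Longrightarrow> b \<longleftrightarrow> i \<in> A"
  by (auto simp: extends_def entry_def)

text \<open>Membership is decided at stage \<open>length \<sigma>\<close>, which makes the tree
  computable. A tip of that stage may be shorter than \<sigma>, hence comparability; strings
  abandoned later remain as dead ends.\<close>

definition tree :: "bool list set" where
  "tree = {\<sigma>. list_ex (\<lambda>\<rho>. prefix \<sigma> \<rho> \<or> prefix \<rho> \<sigma>) (tips (state (length \<sigma>)))}"

lemma downward_closed_tree: "downward_closed tree"
  unfolding downward_closed_def
proof (intro ballI allI impI)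
  fix \<sigma> \<tau> :: "bool list"
  assume "\<sigma> \<in> tree" and \<tau>: "prefix \<tau> \<sigma>"
  then obtain \<rho> where \<rho>: "\<rho> \<in> set (tips (state (length \<sigma>)))" "prefix \<sigma> \<rho> \<or> prefix \<rho> \<sigma>"
    by (auto simp: tree_def list_ex_iff)
  obtain \<rho>' where \<rho>': "\<rho>' \<in> set (tips (state (length \<tau>)))" "prefix \<rho>' \<rho>"
    using tips_state_mono[OF prefix_length_le[OF \<tau>] \<rho>(1)] by blast
  have "prefix \<tau> \<rho>' \<or> prefix \<rho>' \<tau>"
    using \<rho>(2) \<rho>'(2) \<tau> by (meson prefix_order.trans prefix_same_cases)
  then show "\<tau> \<in> tree" using \<rho>'(1) by (auto simp: tree_def list_ex_iff)
qed

lemma computable_strings_tree: "computable_strings tree"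
proof -
  let ?dec = "\<lambda>x. map (\<lambda>b. b = 1) (list_decode x)"
  have "(of_bool :: bool \<Rightarrow> nat) = enc" by (rule ext) simp
  then have enc: "string_encode \<sigma> = enc \<sigma>" for \<sigma>
    by (simp add: string_encode_def enc_list_def del: enc_bool_def)
  have dec: "?dec (enc \<sigma>) = \<sigma>" for \<sigma> :: "bool list"
    by (simp add: enc_list_def comp_def)
  \<comment> \<open>The decoder reads a string off any number; the test
    \<open>enc (?dec x) = x\<close> rejects numbers that do not code a string.\<close>
  have "eff {} (\<lambda>x. enc (?dec x) = x \<and>
      list_ex (\<lambda>\<rho>. prefix (?dec x) \<rho> \<or> prefix \<rho> (?dec x)) (tips (state (length (?dec x)))))"
    by (intro eff_intros)
  then have "eff {} (\<lambda>x. enc (?dec x) = x \<and> ?dec x \<in> tree)"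
    by (simp add: tree_def)
  moreover have "x \<in> string_encode ` tree \<longleftrightarrow> enc (?dec x) = x \<and> ?dec x \<in> tree" for x
  proof
    assume "x \<in> string_encode ` tree"
    then obtain \<sigma> where "\<sigma> \<in> tree" "x = enc \<sigma>" by (auto simp: enc)
    then show "enc (?dec x) = x \<and> ?dec x \<in> tree" by (simp only: dec)
  next
    assume x: "enc (?dec x) = x \<and> ?dec x \<in> tree"
    then have "x = string_encode (?dec x)" by (simp only: enc)
    then show "x \<in> string_encode ` tree" using x by (rule image_eqI[OF _ conjunct2])
  qed
  ultimately show ?thesis
    unfolding computable_strings_def computable_def turing_reducible_iff_eff by simp
qed

text \<open>Presents the class as the intersection of the decreasing clopen sets given by the
  tips.\<close>

lemma paths_tree: "A \<in> paths tree \<longleftrightarrow> (\<forall>s. \<exists>\<rho>\<in>set (tips (state s)). extends A \<rho>)"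
proof (intro iffI allI)
  fix s
  assume A: "A \<in> paths tree"
  \<comment> \<open>At least \<open>s\<close> and at least the length of every tip of stage
    \<open>s\<close>, so that comparability with the initial segment becomes being a prefix of
    it.\<close>
  define n where "n = s + sum_list (map length (tips (state s)))"
  have n: "length \<sigma> \<le> n" if "\<sigma> \<in> set (tips (state s))" for \<sigma>
    using member_le_sum_list[of "length \<sigma>" "map length (tips (state s))"] that by (simp add: n_def)
  let ?\<alpha> = "initial_segment A n"
  have "?\<alpha> \<in> tree" using A by (simp add: paths_def)
  then obtain \<rho> where \<rho>: "\<rho> \<in> set (tips (state n))" "prefix ?\<alpha> \<rho> \<or> prefix \<rho> ?\<alpha>"
    by (auto simp: tree_def list_ex_iff)
  obtain \<sigma> where \<sigma>: "\<sigma> \<in> set (tips (state s))" "prefix \<sigma> \<rho>"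
    using tips_state_mono[OF _ \<rho>(1), of s] by (auto simp: n_def)
  have "prefix \<sigma> ?\<alpha>"
    using \<rho>(2) \<sigma>(2) n[OF \<sigma>(1)] length_initial_segment by (metis prefix_length_prefix prefix_order.trans)
  then show "\<exists>\<rho>\<in>set (tips (state s)). extends A \<rho>"
    using extends_iff_prefix n \<sigma>(1) by blast
next
  assume A: "\<forall>s. \<exists>\<rho>\<in>set (tips (state s)). extends A \<rho>"
  have "initial_segment A n \<in> tree" for n
  proof -
    have "extends A (initial_segment A n)" by (rule extends_initial_segment)
    moreover obtain \<rho> where \<rho>: "\<rho> \<in> set (tips (state n))" "extends A \<rho>" using A by blast
    ultimately have "prefix (initial_segment A n) \<rho> \<or> prefix \<rho> (initial_segment A n)"
      by (meson extends_comparable prefix_same_cases)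
    then show ?thesis using \<rho>(1) by (auto simp: tree_def list_ex_iff)
  qed
  then show "A \<in> paths tree" by (simp add: paths_def)
qed

lemma paths_settled:
  assumes "A \<in> paths tree" "settled s0 st"
  shows "\<exists>\<sigma>\<in>set (tips st). extends A \<sigma>"
proof -
  obtain \<rho> where "\<rho> \<in> set (tips (state s0))" "extends A \<rho>"
    using assms(1) paths_tree by blast
  then show ?thesis
    using coherent_tips_suffix(1)[OF coherent_state settledD[OF assms(2)]] extends_prefix by blast
qed

lemma tips_settled:
  assumes "settled s0 st" "s0 \<le> s" "\<sigma> \<in> set (tips st)"
  shows "\<exists>\<rho>\<in>set (tips (state s)). prefix \<sigma> \<rho>"
  using coherent_tips_suffix(2)[OF coherent_state settledD[OF assms(1,2)] assms(3)] .

lemma tips_long: "\<exists>s0. \<forall>s\<ge>s0. \<forall>\<rho>\<in>set (tips (state s)). m \<le> length \<rho>"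
proof -
  obtain s0 st where st: "length st = m" "settled s0 st" using settled_exists by blast
  have "m \<le> length \<rho>" if "s \<ge> s0" "\<rho> \<in> set (tips (state s))" for s \<rho>
    using suffix_length_le[OF settledD[OF st(2) that(1)]] st(1)
      coherent_tips_length[OF coherent_state that(2)] by simp
  then show ?thesis by blast
qed

lemma settled_Cons_exists:
  obtains s0 L st where "length st = k" "settled s0 (L # st)"
  using settled_exists[of "Suc k"] by (metis length_Suc_conv)

lemma settled_unique:
  assumes "settled s0 st" "settled s1 st'" "length st = length st'"
  shows "st = st'"
proof -
  have "suffix st (state (max s0 s1))" "suffix st' (state (max s0 s1))"
    using assms(1,2) settledD by simp_all
  then show ?thesis
    using assms(3) by (metis suffix_length_suffix suffix_order.antisym order_refl)
qed

lemma paths_tree_nonempty: "paths tree \<noteq> {}"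
proof -
  \<comment> \<open>The final positions of the nodes on settled levels; a path through these is
    never cut off.\<close>
  define good where "good k \<sigma> \<longleftrightarrow> (\<exists>s0 st. length st = k \<and> settled s0 st \<and> \<sigma> \<in> set (tips st))" for k \<sigma>
  have "\<exists>f. \<forall>k. good k (f k) \<and> prefix (f k) (f (Suc k))"
  proof (rule dependent_nat_choice)
    have "good 0 []" by (auto simp: good_def settled_def)
    then show "\<exists>\<sigma>. good 0 \<sigma>" ..
  next
    fix \<sigma> k
    assume "good k \<sigma>"
    then obtain s0 st where st: "length st = k" "settled s0 st" "\<sigma> \<in> set (tips st)"
      by (auto simp: good_def)
    obtain s1 L st' where len: "length st' = k" and st': "settled s1 (L # st')"
      by (rule settled_Cons_exists)
    have "st = st'"
      by (rule settled_unique[OF st(2) settled_suffix[OF st']]) (simp_all add: suffix_Cons st(1) len)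
    then have L: "settled s1 (L # st)" using st' by simp
    obtain \<nu> where \<nu>: "\<nu> \<in> set (fst L)" "fst \<nu> = \<sigma> @ [True]"
      using coherent_child[OF settled_coherent[OF L] st(3)] by blast
    have "prefix \<sigma> (snd \<nu>)"
      using coherent_node_prefix[OF settled_coherent[OF L] \<nu>(1)] \<nu>(2) append_prefixD by metis
    moreover have "good (Suc k) (snd \<nu>)"
      unfolding good_def using L \<nu>(1) st(1) by (intro exI[of _ s1] exI[of _ "L # st"]) simp
    ultimately show "\<exists>\<tau>. good (Suc k) \<tau> \<and> prefix \<sigma> \<tau>" by blast
  qed
  then obtain f where f: "\<And>k. good k (f k)" "\<And>k. prefix (f k) (f (Suc k))" by blast
  have f_mono: "prefix (f k) (f l)" if "k \<le> l" for k l
    using that by (induction l rule: dec_induct) (auto intro: prefix_order.trans f(2))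
  define A where "A = {i. \<exists>k. entry (f k) i True}"
  have A: "extends A (f k)" for k
    unfolding extends_def
  proof (intro allI impI)
    fix i assume "i < length (f k)"
    then have i: "entry (f k) i (f k ! i)" by (simp add: entry_def)
    show "f k ! i \<longleftrightarrow> i \<in> A"
    proof
      show "f k ! i \<Longrightarrow> i \<in> A" using i by (auto simp: A_def)
      assume "i \<in> A"
      then obtain l where "entry (f l) i True" by (auto simp: A_def)
      then have "entry (f (max k l)) i True" "entry (f (max k l)) i (f k ! i)"
        using i f_mono entry_prefix by (metis max.cobounded2, metis max.cobounded1)
      then show "f k ! i" by (simp add: entry_def)
    qed
  qed
  have "\<exists>\<rho>\<in>set (tips (state s)). extends A \<rho>" for s
  proof -
    \<comment> \<open>The string \<open>f k\<close> is then at least as long as every tip of stage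
      \<open>s\<close>, so it extends one of them.\<close>
    define k where "k = sum_list (map length (tips (state s)))"
    obtain s0 st where st: "length st = k" "settled s0 st" "f k \<in> set (tips st)"
      using f(1) unfolding good_def by blast
    obtain \<rho>' where \<rho>': "\<rho>' \<in> set (tips (state (max s s0)))" "prefix (f k) \<rho>'"
      using tips_settled[OF st(2) _ st(3)] by (metis max.cobounded2)
    obtain \<rho> where \<rho>: "\<rho> \<in> set (tips (state s))" "prefix \<rho> \<rho>'"
      using tips_state_mono[OF _ \<rho>'(1), of s] by auto
    have "length \<rho> \<le> k"
      using member_le_sum_list[of "length \<rho>" "map length (tips (state s))"] \<rho>(1) by (simp add: k_def)
    also have "k \<le> length (f k)"
      using coherent_tips_length[OF settled_coherent[OF st(2)] st(3)] st(1) by simp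
    finally have "prefix \<rho> (f k)" using prefix_length_prefix[OF \<rho>(2) \<rho>'(2)] by simp
    then show ?thesis using A extends_prefix \<rho>(1) by blast
  qed
  then show ?thesis using paths_tree by blast
qed

section \<open>The enumerated set and the absence of computable members\<close>

definition enumerated :: "nat set" where
  "enumerated = {x. \<exists>s. list_ex (\<lambda>L. list_ex (\<lambda>q. x = witness L q) (snd (snd L))) (state s)}"

lemma enumerated_reducible: "enumerated \<le>\<^sub>T halting_set"
  unfolding enumerated_def by (rule ce_reducible_halting_set) (intro eff_intros)

text \<open>A witness determines requirement and creation stage, so only \<open>L\<close> or an
  earlier version of it can have contributed it; \<open>done_mono\<close> passes to the settled
  version.\<close>

lemma witness_enumerated_iff:
  assumes "settled s0 (L # st)"
  shows "witness L q \<in> enumerated \<longleftrightarrow> q \<in> set (snd (snd L))"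
proof
  have L: "L \<in> set (state s)" if "s0 \<le> s" for s
    using set_mono_suffix[OF settledD[OF assms that]] by simp
  show "q \<in> set (snd (snd L))" if wit: "witness L q \<in> enumerated"
  proof -
    obtain s M q' where M: "M \<in> set (state s)" "q' \<in> set (snd (snd M))" "witness L q = witness M q'"
      using wit unfolding enumerated_def list_ex_iff mem_Collect_eq by blast
    then have "q = q'" "fst (snd M) = fst (snd L)" by (simp_all add: witness_def)
    then show ?thesis
      using done_mono[OF _ M(1) L[of "max s s0"]] M(2) by (simp add: subset_iff)
  qed
  show "witness L q \<in> enumerated" if "q \<in> set (snd (snd L))"
    using L[OF order_refl] that unfolding enumerated_def list_ex_iff mem_Collect_eq by blast
qed

lemma special_paths_tree:
  assumes "A \<in> paths tree"
  shows "\<not> computable A"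
proof
  assume "computable A"
  then obtain e where e: "\<And>x. eval {} (\<Psi> e) x (of_bool (x \<in> A))"
    unfolding computable_def turing_reducible_def by blast
  define q where "q = prod_encode (e, list_encode [])"
  have q: "fst (prod_decode q) = e" "list_decode (snd (prod_decode q)) = []"
    by (simp_all add: q_def)
  \<comment> \<open>Height \<open>e\<close> suffices for \<open>q\<close> to be allowed. The settled
    level above it provides tips beyond both successors of every node of \<open>L\<close>.\<close>
  obtain s0 L' st' where "length st' = Suc e" and L': "settled s0 (L' # st')"
    by (rule settled_Cons_exists)
  then obtain L st where st: "st' = L # st" "length st = e" by (metis length_Suc_conv)
  have L': "settled s0 (L' # L # st)" using L' st(1) by simp
  have L: "settled s0 (L # st)" by (rule settled_suffix[OF L']) (simp add: suffix_Cons)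
  note coh = settled_coherent[OF L'] and coh' = settled_coherent[OF L]
  show False
  proof (cases "q \<in> set (snd (snd L))")
    case True
    have "level_ok L" using coh' by simp
    then obtain d where d: "derivation d" "\<forall>\<nu>\<in>set (fst L). supports q (witness L q) d (fst \<nu>) (snd \<nu>)"
      using True unfolding level_ok_def by blast
    \<comment> \<open>The requirement was met, so the node on \<open>A\<close> carries a bit that
      differs from the value computed by \<open>e\<close>.\<close>
    obtain \<nu> where \<nu>: "\<nu> \<in> set (fst L)" "extends A (snd \<nu>)"
      using paths_settled[OF assms L] by auto
    have sup: "supports q (witness L q) d (fst \<nu>) (snd \<nu>)" using d(2) \<nu>(1) by blast
    have ans: "answers_from {} d"
      using sup by (auto simp: supports_def q list_all_iff answers_from_def)
    have "list_ex (\<lambda>t. fst t = e \<and> entry (snd \<nu>) (fst (snd t)) (snd (snd t) \<noteq> 1)) d"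
      using sup by (simp add: supports_def q)
    then obtain y b where yb: "(e, y, b) \<in> set d" "entry (snd \<nu>) y (b \<noteq> 1)"
      unfolding list_ex_iff by (metis prod.collapse)
    have "eval {} (\<Psi> e) y b" by (rule derivation_sound[OF d(1) ans]) (simp add: yb(1))
    then have "b = of_bool (y \<in> A)" using e by (rule eval_deterministic)
    then show False using extends_entry[OF \<nu>(2) yb(2)] by (cases "y \<in> A") simp_all
  next
    case False
    \<comment> \<open>The values of \<open>e\<close> just beyond the end of every node; each node
      can then be extended by the opposite bit.\<close>
    let ?T = "(\<lambda>\<nu>. (e, length (snd \<nu>), of_bool (length (snd \<nu>) \<in> A))) ` set (fst L)"
    obtain d where d: "derivation d" "answers_from {} d" "?T \<subseteq> set d"
    proof (rule finite_derivation[of ?T "{}"])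
      show "derivable {} t" if "t \<in> ?T" for t
        using that derivation_complete[OF e] unfolding functional_encode_\<Psi> by blast
    qed (simp_all add: that)
    define p where "p = prod_encode (q, enc d)"
    define s where "s = max s0 (Suc p)"
    have "enabled (length st) (tips (state s)) L p"
    proof -
      have "\<exists>\<rho>\<in>set (tips (state s)). prefix (snd \<nu>) \<rho> \<and> supports q (witness L q) d (fst \<nu>) \<rho>"
        if \<nu>: "\<nu> \<in> set (fst L)" for \<nu>
      proof -
        let ?l = "length (snd \<nu>)" and ?\<sigma> = "snd \<nu> @ [length (snd \<nu>) \<notin> A]"
        obtain \<mu> where \<mu>: "\<mu> \<in> set (fst L')" "fst \<mu> = ?\<sigma>"
          using coherent_child[OF coh, of "snd \<nu>"] \<nu> by (metis imageI set_map tips_Cons)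
        obtain \<rho> where \<rho>: "\<rho> \<in> set (tips (state s))" "prefix (snd \<mu>) \<rho>"
          using tips_settled[OF L', of s "snd \<mu>"] \<mu>(1) by (auto simp: s_def)
        have pre: "prefix ?\<sigma> \<rho>"
          using coherent_node_prefix[OF coh \<mu>(1)] \<mu>(2) \<rho>(2) by (metis prefix_order.trans)
        have "entry ?\<sigma> ?l (?l \<notin> A)" by (simp add: entry_def)
        then have "entry \<rho> ?l ((of_bool (?l \<in> A) :: nat) \<noteq> 1)"
          using entry_prefix[OF _ pre] by (cases "?l \<in> A") simp_all
        moreover have "(e, ?l, of_bool (?l \<in> A)) \<in> set d" using d(3) \<nu> by blast
        ultimately have "list_ex (\<lambda>t. fst t = e \<and> entry \<rho> (fst (snd t)) (snd (snd t) \<noteq> 1)) d"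
          unfolding list_ex_iff by (intro bexI[of _ "(e, ?l, of_bool (?l \<in> A))"]) simp_all
        moreover have "list_all (\<lambda>t. fst t = 4 \<longrightarrow> snd (snd t) = 0) d"
          using d(2) by (auto simp: answers_from_def list_all_iff)
        ultimately have "supports q (witness L q) d (fst \<nu>) \<rho>"
          by (simp add: supports_def q)
        then show ?thesis using \<rho>(1) pre append_prefixD by blast
      qed
      then show ?thesis
        using False d(1) st(2) by (simp add: enabled_def p_def allowed_def q list_all_iff list_ex_iff)
    qed
    moreover have "s0 \<le> s" "p < s" by (simp_all add: s_def)
    ultimately show False using settled_not_enabled[OF L] by blast
  qed
qed

section \<open>Finite joins of members\<close>

lemma mem_finite_join: "z \<in> finite_join n A \<longleftrightarrow> z div Suc n \<in> A (z mod Suc n)"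
proof
  assume "z \<in> finite_join n A"
  then obtain i j where "z = Suc n * i + j" "j \<le> n" "i \<in> A j"
    by (auto simp: finite_join_def)
  then show "z div Suc n \<in> A (z mod Suc n)"
    by (simp only: div_mult_self4 mod_mult_self4) simp
next
  assume "z div Suc n \<in> A (z mod Suc n)"
  moreover have "z = (n + 1) * (z div Suc n) + z mod Suc n"
    unfolding Suc_eq_plus1 by (simp only: mult_div_mod_eq)
  moreover have "z mod Suc n \<le> n"
    by (simp add: less_Suc_eq_le[symmetric])
  ultimately show "z \<in> finite_join n A" unfolding finite_join_def by blast
qed

text \<open>Finitely many pairs need finitely many points of difference. The bound \<open>m\<close>
  tells how long names must be to keep distinct members apart.\<close>

lemma finite_separation:
  fixes A :: "nat \<Rightarrow> nat set"
  shows "\<exists>m. \<forall>i\<le>n. \<forall>j\<le>n. (\<forall>x<m. x \<in> A i \<longleftrightarrow> x \<in> A j) \<longrightarrow> A i = A j"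
proof -
  have "\<exists>x. A i \<noteq> A j \<longrightarrow> (x \<in> A i) \<noteq> (x \<in> A j)" for i j by blast
  then obtain w where w: "\<And>i j. A i \<noteq> A j \<Longrightarrow> (w i j \<in> A i) \<noteq> (w i j \<in> A j)" by metis
  let ?W = "(\<lambda>(i, j). w i j) ` ({..n} \<times> {..n})"
  have "w i j < Suc (Max ?W)" if "i \<le> n" "j \<le> n" for i j
    using that by (intro le_imp_less_Suc Max_ge) auto
  then show ?thesis using w by (intro exI[of _ "Suc (Max ?W)"]) blast
qed

lemma join_not_computes_enumerated:
  assumes A: "\<And>i. i \<le> n \<Longrightarrow> A i \<in> paths tree"
  shows "\<not> enumerated \<le>\<^sub>T finite_join n A"
proof
  let ?J = "finite_join n A"
  assume "enumerated \<le>\<^sub>T ?J"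
  then obtain e where e: "\<And>x. eval ?J (\<Psi> e) x (of_bool (x \<in> enumerated))"
    unfolding turing_reducible_def by blast
  obtain m where m: "\<And>i j. i \<le> n \<Longrightarrow> j \<le> n \<Longrightarrow> (\<And>x. x < m \<Longrightarrow> x \<in> A i \<longleftrightarrow> x \<in> A j) \<Longrightarrow> A i = A j"
    using finite_separation[of n A] by blast
  \<comment> \<open>The summands admit the index \<open>e\<close> and the \<open>Suc n\<close>
    columns, and make the names longer than \<open>m\<close>.\<close>
  obtain s0 L st where st: "length st = e + Suc n + m" and L: "settled s0 (L # st)"
    by (rule settled_Cons_exists)
  note coh = settled_coherent[OF L]
  have "\<exists>\<nu>\<in>set (fst L). extends (A i) (snd \<nu>)" if "i \<le> n" for i
    using paths_settled[OF A[OF that] L] by auto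
  then obtain \<nu> where \<nu>: "\<And>i. i \<le> n \<Longrightarrow> \<nu> i \<in> set (fst L) \<and> extends (A i) (snd (\<nu> i))" by metis
  have \<nu>': "extends (A i) (fst (\<nu> i))" if "i \<le> n" for i
    using \<nu>[OF that] coherent_node_prefix[OF coh] extends_prefix by blast
  define ps where "ps = map (\<lambda>i. enc (fst (\<nu> i))) [0..<Suc n]"
  define q where "q = prod_encode (e, list_encode ps)"
  define x where "x = witness L q"
  have ps: "ps \<noteq> []" "length ps = Suc n" by (simp_all add: ps_def del: upt_Suc)
  have q: "fst (prod_decode q) = e" "list_decode (snd (prod_decode q)) = ps"
    by (simp_all add: q_def)
  have entry_ps: "entry ps i (enc \<pi>) \<longleftrightarrow> i \<le> n \<and> fst (\<nu> i) = \<pi>" for i \<pi>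
    by (auto simp: entry_def ps_def less_Suc_eq_le simp del: upt_Suc)
  have mod_le: "z mod Suc n \<le> n" for z
    by (simp add: less_Suc_eq_le[symmetric])
  have supports_iff: "supports q x d \<pi> \<rho> \<longleftrightarrow> (e, x, 0) \<in> set d \<and>
      (\<forall>z b. (4, z, b) \<in> set d \<longrightarrow> fst (\<nu> (z mod Suc n)) = \<pi> \<longrightarrow> entry \<rho> (z div Suc n) (b = 1))" for d \<pi> \<rho>
  proof -
    have "list_all P d \<longleftrightarrow> (\<forall>f z b. (f, z, b) \<in> set d \<longrightarrow> P (f, z, b))" for P
      by (auto simp: list_all_iff)
    then show ?thesis by (simp add: supports_def q ps entry_ps mod_le)
  qed
  show False
  proof (cases "q \<in> set (snd (snd L))")
    case True
    have "level_ok L" using coh by simp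
    then obtain d where d: "derivation d" "\<forall>\<nu>\<in>set (fst L). supports q x d (fst \<nu>) (snd \<nu>)"
      using True unfolding level_ok_def x_def by blast
    have sup: "(e, x, 0) \<in> set d" "\<And>z b. (4, z, b) \<in> set d \<Longrightarrow> fst (\<nu> (z mod Suc n)) = fst (\<nu> i) \<Longrightarrow>
        entry (snd (\<nu> i)) (z div Suc n) (b = 1)" if "i \<le> n" for i
      using bspec[OF d(2) conjunct1[OF \<nu>[OF that]]] unfolding supports_iff by blast+
    \<comment> \<open>The answers about a column are bits of the node through which the set of that
      column passes, hence the true ones.\<close>
    have "answers_from ?J d"
      unfolding answers_from_def
    proof (intro allI impI)
      fix z b
      assume zb: "(4, z, b) \<in> set d"
      \<comment> \<open>The \<open>entry\<close> claim only tells whether \<open>b\<close> is 1;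
        that no other positive value occurs comes from the derivation.\<close>
      have "b \<le> 1"
      proof -
        obtain d' where "justified d' (4, z, b)" using d(1) zb by (induction d) auto
        then show ?thesis by simp
      qed
      moreover have "b = 1 \<longleftrightarrow> z div Suc n \<in> A (z mod Suc n)"
        using extends_entry \<nu>[OF mod_le] sup(2)[OF mod_le zb] by blast
      ultimately show "b = of_bool (z \<in> ?J)" by (auto simp: mem_finite_join)
    qed
    then have "eval ?J (\<Psi> e) x 0"
      by (rule derivation_sound[OF d(1)]) (simp add: sup(1)[of 0])
    then have "x \<notin> enumerated" using e eval_deterministic by fastforce
    then show False using True witness_enumerated_iff[OF L] by (simp add: x_def)
  next
    case False
    then have "x \<notin> enumerated" using witness_enumerated_iff[OF L] by (simp add: x_def)
    then have "eval ?J (\<Psi> e) x 0" using e[of x] by simp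
    from derivation_complete[OF this] obtain d where d: "derivation d" "answers_from ?J d" "(e, x, 0) \<in> set d"
      unfolding derivable_def by auto
    \<comment> \<open>Exceeds every number queried in \<open>d\<close>, so a tip of length at least
      \<open>u\<close> contains each bit asked for.\<close>
    define u where "u = sum_list (map (\<lambda>t. Suc (fst (snd t))) d)"
    have u: "z < u" if "(4, z, b) \<in> set d" for z b
      using member_le_sum_list[of "Suc z" "map (\<lambda>t. Suc (fst (snd t))) d"] that
      by (force simp: u_def)
    obtain s1 where s1: "\<And>s \<rho>. s \<ge> s1 \<Longrightarrow> \<rho> \<in> set (tips (state s)) \<Longrightarrow> u \<le> length \<rho>"
      using tips_long by blast
    define p where "p = prod_encode (q, enc d)"
    define s where "s = max (max s0 s1) (Suc p)"
    have s: "s0 \<le> s" "s1 \<le> s" "p < s" by (simp_all add: s_def)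
    \<comment> \<open>A node on some \<open>A i\<close> is sent to the tip on \<open>A i\<close>.
      Any tip above it will do for another node, since none of the columns bears its name.\<close>
    have "\<exists>\<rho>\<in>set (tips (state s)). prefix (snd \<mu>) \<rho> \<and> supports q x d (fst \<mu>) \<rho>"
      if \<mu>: "\<mu> \<in> set (fst L)" for \<mu>
    proof (cases "\<exists>i\<le>n. \<mu> = \<nu> i")
      case True
      then obtain i where i: "i \<le> n" "\<mu> = \<nu> i" by blast
      obtain \<rho> where \<rho>: "\<rho> \<in> set (tips (state s))" "extends (A i) \<rho>"
        using A[OF i(1)] paths_tree by blast
      obtain \<sigma> where \<sigma>: "\<sigma> \<in> set (tips (L # st))" "prefix \<sigma> \<rho>"
        using coherent_tips_suffix(1)[OF coherent_state settledD[OF L s(1)] \<rho>(1)] by blast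
      \<comment> \<open>Both \<sigma> and \<open>snd \<mu>\<close> are initial segments of
        \<open>A i\<close>, and tips of a level are incomparable, so they coincide.\<close>
      obtain \<upsilon> where "prefix (snd \<mu>) \<upsilon>" "prefix \<rho> \<upsilon>"
        using extends_comparable[OF _ \<rho>(2)] \<nu>[OF i(1)] i(2) by blast
      then have "\<sigma> = snd \<mu>"
        using coherent_tips_incomparable[OF coh \<sigma>(1), of "snd \<mu>" \<upsilon>] \<sigma>(2) \<mu>
        by (simp add: prefix_order.trans)
      moreover have "entry \<rho> (z div Suc n) (b = 1)"
        if zb: "(4, z, b) \<in> set d" and j: "fst (\<nu> (z mod Suc n)) = fst \<mu>" for z b
      proof -
        let ?j = "z mod Suc n"
        \<comment> \<open>Sets passing through the same node agree below \<open>m\<close> and are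
          therefore equal, so \<rho> answers correctly for every column that bears this
          name.\<close>
        have "A ?j = A i"
        proof (rule m[OF mod_le i(1)])
          fix y assume "y < m"
          then have "y < length (fst \<mu>)" using coherent_length[OF coh \<mu>] st by simp
          then show "y \<in> A ?j \<longleftrightarrow> y \<in> A i"
            using \<nu>'[OF mod_le, of z] \<nu>'[OF i(1)] j i(2) unfolding extends_def by metis
        qed
        moreover have "b = of_bool (z div Suc n \<in> A ?j)"
          using d(2) zb by (simp add: answers_from_def mem_finite_join)
        moreover have "z div Suc n < length \<rho>"
          using u[OF zb] s1[OF s(2) \<rho>(1)] div_le_dividend[of z "Suc n"] by linarith
        ultimately show ?thesis using \<rho>(2) by (simp add: entry_def extends_def)
      qed
      then have "supports q x d (fst \<mu>) \<rho>"
        using d(3) unfolding supports_iff by blast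
      ultimately show ?thesis using \<rho>(1) \<sigma>(2) by blast
    next
      case False
      have "fst (\<nu> i) \<noteq> fst \<mu>" if "i \<le> n" for i
        using False that coherent_nodes_incomparable[OF coh _ \<mu>, of "\<nu> i" "fst \<mu>"] \<nu>[OF that] by auto
      then have "supports q x d (fst \<mu>) \<rho>" for \<rho>
        using d(3) mod_le unfolding supports_iff by blast
      moreover obtain \<rho> where "\<rho> \<in> set (tips (state s))" "prefix (snd \<mu>) \<rho>"
        using tips_settled[OF L s(1), of "snd \<mu>"] \<mu> by auto
      ultimately show ?thesis by blast
    qed
    moreover have "allowed (length st) L q"
    proof -
      have "list_all (\<lambda>i. i \<in> set (map (\<lambda>\<nu>. enc (fst \<nu>)) (fst L))) ps"
        unfolding ps_def list_all_iff set_map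
      proof (intro ballI, elim imageE)
        fix y i
        assume "y = enc (fst (\<nu> i))" "i \<in> set [0..<Suc n]"
        then show "y \<in> (\<lambda>\<nu>. enc (fst \<nu>)) ` set (fst L)" using \<nu>[of i] by (simp del: upt_Suc)
      qed
      then show ?thesis using st ps(2) by (simp add: allowed_def q)
    qed
    ultimately have "enabled (length st) (tips (state s)) L p"
      using False d(1) unfolding enabled_def p_def x_def list_all_iff list_ex_iff by simp
    then show False using settled_not_enabled[OF L s(1,3)] by blast
  qed
qed

theorem theorem1:
  "\<exists>P :: nat \<Rightarrow> nat set set.
     (\<forall>n. P n \<noteq> {} \<and> special_pi01_class (P n)) \<and>
     (\<forall>(n :: nat) (A :: nat \<Rightarrow> nat set).
        (\<forall>i\<le>n. \<exists>k. A i \<in> P k) \<longrightarrow> \<not> halting_set \<le>\<^sub>T finite_join n A)"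
proof (intro exI[of _ "\<lambda>_. paths tree"] conjI allI impI)
  show "special_pi01_class (paths tree)"
    unfolding special_pi01_class_def pi01_class_def
    using computable_strings_tree downward_closed_tree special_paths_tree by blast
next
  fix n and A :: "nat \<Rightarrow> nat set"
  assume "\<forall>i\<le>n. \<exists>k. A i \<in> paths tree"
  \<comment> \<open>A join computing the halting set would also compute
    \<open>enumerated\<close>.\<close>
  then show "\<not> halting_set \<le>\<^sub>T finite_join n A"
    using join_not_computes_enumerated[of n A] turing_reducible_trans[OF enumerated_reducible] by blast
qed (rule paths_tree_nonempty)

end
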